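(* For any $d\in\mathbb{N}$ and any $0\leq\alpha<d$, there exists a non-empty compact set $K\subset\mathbb{R}^d$ such that $\dim_{\mathrm{H}} K=\dim_{\mathrm{A}} K=\alpha$, but $\dim_{\mathrm{ML}} E=0$ for every microset $E\in\mathcal{G}_K$. In particular, for every $s>0$ and every $E\in\mathcal{G}_K$, $E$ does not contain an Ahlfors--David $s$-regular subset.
   Context: $B(x,r)$ denotes the closed ball of centre $x$ and radius $r$, and $N_r(F)$ denotes the minimal number of closed balls of radius $r$ centred in $F$ needed to cover $F$. $\dim_{\mathrm{H}}$ is Hausdorff dimension. For a non-empty compact $K\subset\mathbb{R}^d$, a miniset of $K$ is a non-empty compact set of the form $\lambda(K-x)\cap B(0,1)$ with $x\in K$ and $\lambda\geq1$; a microset of $K$ is any limit, in the Hausdorff metric, of a sequence of minisets of $K$; $\mathcal{G}_K$ denotes the set of microsets of $K$. The Assouad dimension is $\dim_{\mathrm{A}} K=\inf\{\alpha>0:\exists C>0\ \forall 0<r\leq R<1\ \forall x\in K,\ N_r(B(x,R)\cap K)\leq C(R/r)^\alpha\}$. The lower dimension of a non-empty set $F$ is $\dim_{\mathrm{L}} F=\sup\{\alpha>0:\exists C>0\ \forall 0<r\leq R<1\ \forall x\in F,\ N_r(B(x,R)\cap F)\geq C(R/r)^\alpha\}$ (with $\sup\varnothing=0$). The modified lower dimension is $\dim_{\mathrm{ML}} E=\sup\{\dim_{\mathrm{L}} F:\varnothing\neq F\subset E\}$. A set $F$ is Ahlfors--David $s$-regular if it is closed and there is $C\geq1$ with $C^{-1}r^s\leq\mathcal{H}^s(F\cap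 B(x,r))\leq Cr^s$ for all $x\in F$ and $0<r<\operatorname{diam}F$, where $\mathcal{H}^s$ is $s$-dimensional Hausdorff measure.
   Formalization: In the last sentence, Ahlfors–David s-regular subsets are required to contain at least two points, because the empty set and one-point sets satisfy the definition vacuously (no r has 0 < r < diam F = 0). *)

theory Defs
  imports "HOL-Analysis.Analysis" "HOL-Library.Extended_Real" "HOL-Library.Extended_Nonnegative_Real"
begin

text \<open>Covering number N_r(F): minimal number of closed balls of radius r centred in F
  needed to cover F (only used for bounded sets, where such finite covers exist).\<close>
definition covnum :: "'a::metric_space set \<Rightarrow> real \<Rightarrow> nat" where
  "covnum F r = Inf {card C | C. finite C \<and> C \<subseteq> F \<and> F \<subseteq> (\<Union>c\<in>C. cball c r)}"

definition hdist :: "'a::metric_space set \<Rightarrow> 'a set \<Rightarrow> real" where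
  "hdist A B = max (SUP a\<in>A. infdist a B) (SUP b\<in>B. infdist b A)"

definition miniset :: "'a::real_normed_vector set \<Rightarrow> 'a set \<Rightarrow> bool" where
  "miniset K M \<longleftrightarrow> (\<exists>x\<in>K. \<exists>lam::real. lam \<ge> 1 \<and>
        M = (\<lambda>v. lam *\<^sub>R (v - x)) ` K \<inter> cball 0 1)"

definition microsets :: "'a::real_normed_vector set \<Rightarrow> 'a set set" where
  "microsets K = {E. E \<noteq> {} \<and> compact E \<and>
     (\<exists>M::nat \<Rightarrow> 'a set. (\<forall>n. miniset K (M n)) \<and> (\<lambda>n. hdist (M n) E) \<longlonglongrightarrow> 0)}"

definition assouad_dim :: "'a::metric_space set \<Rightarrow> ereal" where
  "assouad_dim K = Inf (ereal ` {a. a > 0 \<and> (\<exists>C>0. \<forall>r R x. 0 < r \<and> r \<le> R \<and> R < 1 \<and> x \<in> K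
        \<longrightarrow> real (covnum (cball x R \<inter> K) r) \<le> C * (R / r) powr a)})"

definition lower_dim :: "'a::metric_space set \<Rightarrow> ereal" where
  "lower_dim F = Sup (insert 0 (ereal ` {a. a > 0 \<and> (\<exists>C>0. \<forall>r R x. 0 < r \<and> r \<le> R \<and> R < 1 \<and> x \<in> F
        \<longrightarrow> real (covnum (cball x R \<inter> F) r) \<ge> C * (R / r) powr a)}))"

definition mod_lower_dim :: "'a::metric_space set \<Rightarrow> ereal" where
  "mod_lower_dim E = Sup {lower_dim F | F. F \<noteq> {} \<and> F \<subseteq> E}"

definition hausdorff_pre :: "real \<Rightarrow> real \<Rightarrow> 'a::metric_space set \<Rightarrow> ennreal" where
  "hausdorff_pre s \<delta> A = (INF U \<in> {U :: nat \<Rightarrow> 'a set. A \<subseteq> (\<Union>i. U i) \<and> (\<forall>i. bounded (U i) \<and> diameter (U i) \<le> \<delta>)}.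
      (\<Sum>i. (if U i = {} then 0 else if s = 0 then 1 else ennreal (diameter (U i) powr s))))"

definition hausdorff_measure :: "real \<Rightarrow> 'a::metric_space set \<Rightarrow> ennreal" where
  "hausdorff_measure s A = (SUP \<delta>\<in>{0<..}. hausdorff_pre s \<delta> A)"

definition hausdorff_dim :: "'a::metric_space set \<Rightarrow> ereal" where
  "hausdorff_dim A = Inf (ereal ` {s. s \<ge> 0 \<and> hausdorff_measure s A = 0})"

definition AD_regular :: "real \<Rightarrow> 'a::metric_space set \<Rightarrow> bool" where
  "AD_regular s F \<longleftrightarrow> closed F \<and> (\<exists>C\<ge>1. \<forall>x\<in>F. \<forall>r. 0 < r \<and> r < diameter F \<longrightarrow>
      ennreal (r powr s / C) \<le> hausdorff_measure s (F \<inter> cball x r) \<and>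
      hausdorff_measure s (F \<inter> cball x r) \<le> ennreal (C * r powr s))"

end

theory Submission
  imports Defs
begin

text \<open>\<open>K\<close> is the set of all sums \<open>\<Sum>k. L k * v k\<close> with \<open>v k\<close> a 0/1 vector of length \<open>n\<close>,
  where \<open>L k = 2 powr (- t k)\<close> and the steps of \<open>t\<close> are bounded below by some \<open>c > 1\<close>, so that
  \<open>K\<close> is bi-Lipschitz to an ultrametric space of sequences.
  The scales are chosen such that \<open>t\<close> grows on average by \<open>n / \<alpha>\<close> per step (superlinearly if \<open>\<alpha> = 0\<close>),
  which gives dimension \<open>\<alpha>\<close>, and such that for each \<open>m\<close> every sufficiently long window of indices contains a step
  larger than \<open>m\<close>. At such a step all points of \<open>K\<close> are simultaneously isolated
  in a thick annulus; since these steps occur with bounded gaps, every point of every microset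
  \<open>E\<close> is isolated in annuli of arbitrarily large ratio. This property passes to all subsets of
  \<open>E\<close> and contradicts positive lower dimension as well as Ahlfors-David regularity.\<close>

section \<open>Scales with syndetic gaps\<close>

text \<open>By Legendre's formula this is the multiplicity of 2 in \<open>k!\<close>. It is
  superadditive with \<open>legendre k / k \<longlonglongrightarrow> 1\<close>, yet it jumps by at least \<open>m\<close> once in every
  \<open>2 ^ m\<close> consecutive steps.\<close>

definition legendre :: "nat \<Rightarrow> nat" where
  "legendre k = (\<Sum>i=1..k. k div 2 ^ i)"

text \<open>Terms with index above \<open>k\<close> vanish since \<open>k < 2 ^ k\<close>. A common
  summation range lets values at different arguments be compared term by term.\<close>

lemma legendre_eq:
  assumes "k \<le> N"
  shows "legendre k = (\<Sum>i=1..N. k div 2 ^ i)"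
  unfolding legendre_def
proof (rule sum.mono_neutral_left)
  have "k div 2 ^ i = 0" if "i > k" for i
  proof -
    have "k < 2 ^ k" by simp
    also have "(2::nat) ^ k \<le> 2 ^ i" using that by simp
    finally show ?thesis by simp
  qed
  then show "\<forall>i\<in>{1..N} - {1..k}. k div 2 ^ i = 0" by auto
qed (use assms in auto)

text \<open>Integer division is superadditive in each term, the defect being a carry. This makes the
  growth of \<open>t\<close> uniform in the starting index.\<close>

lemma legendre_superadditive: "legendre a + legendre b \<le> legendre (a + b)"
proof -
  have "legendre a + legendre b = (\<Sum>i=1..a+b. a div 2 ^ i + b div 2 ^ i)"
    by (simp add: legendre_eq[of a "a + b"] legendre_eq[of b "a + b"] sum.distrib)
  also have "\<dots> \<le> (\<Sum>i=1..a+b. (a + b) div 2 ^ i)"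
    by (intro sum_mono) (simp add: div_add1_eq[of a b])
  finally show ?thesis by (simp add: legendre_def)
qed

lemma sum_half_powers: "(\<Sum>i=1..N. real n / 2 ^ i) = real n * (1 - 1 / 2 ^ N)"
proof (induction N)
  case (Suc N)
  then show ?case by (simp add: right_diff_distrib)
qed simp

lemma legendre_le: "legendre k \<le> k"
proof -
  have "real (legendre k) \<le> (\<Sum>i=1..k. real k / 2 ^ i)"
    unfolding legendre_def of_nat_sum
    by (intro sum_mono order_trans[OF of_nat_div_le_of_nat]) auto
  also have "\<dots> \<le> real k"
    unfolding sum_half_powers by (simp add: mult_left_le)
  finally show ?thesis by simp
qed

text \<open>Truncating after \<open>I\<close> terms costs at most 1 per floor, so the slope comes
  arbitrarily close to 1 at the price of a constant independent of \<open>k\<close>.\<close>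

lemma legendre_ge: "real (legendre k) \<ge> real k * (1 - 1 / 2 ^ I) - real I"
proof -
  have "real k * (1 - 1 / 2 ^ I) - real I = (\<Sum>i=1..I. real k / 2 ^ i - 1)"
    unfolding sum_subtractf sum_half_powers by simp
  also have "\<dots> \<le> (\<Sum>i=1..I. real (k div 2 ^ i))"
  proof (intro sum_mono)
    fix i
    have "real_of_int (int k) / real_of_int (2 ^ i) - real_of_int (int k div 2 ^ i) \<le> 1"
      by (rule real_of_int_div3)
    also have "int k div 2 ^ i = int (k div 2 ^ i)" by (simp add: zdiv_int)
    finally show "real k / 2 ^ i - 1 \<le> real (k div 2 ^ i)" by simp
  qed
  \<comment> \<open>The maximum covers the case \<open>I > k\<close>, where the sum defining
    \<open>legendre k\<close> is the shorter one.\<close>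
  also have "\<dots> \<le> (\<Sum>i=1..max I k. real (k div 2 ^ i))"
    by (intro sum_mono2) auto
  also have "\<dots> = real (legendre k)"
    by (simp add: legendre_eq[of k "max I k"])
  finally show ?thesis .
qed

text \<open>For each \<open>i \<le> m\<close> the quotient by \<open>2 ^ i\<close> increases by one
  on reaching \<open>Suc k\<close>, a multiple of \<open>2 ^ i\<close>.\<close>

lemma legendre_jump:
  assumes "2 ^ m dvd Suc k"
  shows "legendre (Suc k) \<ge> legendre k + m"
proof -
  have m: "m \<le> Suc k"
  proof -
    have "m < 2 ^ m" by simp
    also have "\<dots> \<le> Suc k" using assms by (simp add: dvd_imp_le)
    finally show ?thesis by simp
  qed
  have "legendre k + m = (\<Sum>i=1..Suc k. k div 2 ^ i + (if i \<le> m then 1 else 0))"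
  proof -
    have "{1..Suc k} \<inter> {i. i \<le> m} = {1..m}" using m by auto
    then show ?thesis
      by (simp add: legendre_eq[of k "Suc k"] sum.distrib sum.If_cases del: sum.cl_ivl_Suc)
  qed
  also have "\<dots> \<le> (\<Sum>i=1..Suc k. Suc k div 2 ^ i)"
  proof (intro sum_mono)
    fix i
    have "2 ^ i dvd Suc k" if "i \<le> m"
      using assms le_imp_power_dvd[OF that] dvd_trans by blast
    then show "k div 2 ^ i + (if i \<le> m then 1 else 0) \<le> Suc k div 2 ^ i"
      by (auto simp: div_Suc mod_eq_0_iff_dvd div_le_mono)
  qed
  finally show ?thesis by (simp add: legendre_def)
qed

section \<open>Choice of the exponents of the scales\<close>

text \<open>The step bound makes consecutive scales shrink by a factor below 1/2; the upper bound on
  \<open>\<alpha> * t k\<close> yields the Hausdorff dimension, the estimate for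
  \<open>a > \<alpha>\<close> the Assouad dimension, and the last property the annuli in
  microsets.\<close>

lemma exists_scales:
  fixes \<alpha> d :: real
  assumes "0 \<le> \<alpha>" "\<alpha> < d"
  obtains t :: "nat \<Rightarrow> real" and c :: real where
    "c > 1" "t 0 = 0" "\<And>k. t (Suc k) \<ge> t k + c" "\<And>k. \<alpha> * t k \<le> d * real k"
    "\<And>a. a > \<alpha> \<Longrightarrow> \<exists>C. \<forall>k n. d * real n \<le> a * (t (k + n) - t k) + C"
    "\<And>m. \<exists>N. \<forall>k. \<exists>j\<in>{k..k+N}. t (Suc j) - t j \<ge> m"
proof (cases "\<alpha> = 0")
  case True
  show thesis
  proof (rule that[of 2 "\<lambda>k. 2 * (real k)\<^sup>2"])
    show "2 * (real (Suc k))\<^sup>2 \<ge> 2 * (real k)\<^sup>2 + 2" for k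
      by (simp add: power2_eq_square algebra_simps)
    show "\<alpha> * (2 * (real k)\<^sup>2) \<le> d * real k" for k
      using True assms by simp
  next
    fix a :: real assume "a > \<alpha>"
    then have a: "a > 0" using True by simp
    have "d * real n \<le> a * (2 * (real (k + n))\<^sup>2 - 2 * (real k)\<^sup>2) + d\<^sup>2 / a" for k n
    proof -
      define x y where "x = real n" and "y = real k"
      \<comment> \<open>Completing the square produces the constant \<open>d\<^sup>2 / a\<close>;
        the mixed term in \<open>x\<close> and \<open>y\<close> is non-negative, so the estimate is
        uniform in \<open>k\<close>.\<close>
      have "0 \<le> (a * x - d)\<^sup>2 / a + d * x + a * x\<^sup>2 + 4 * a * y * x"
        using a assms by (intro add_nonneg_nonneg mult_nonneg_nonneg) (auto simp: x_def y_def)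
      also have "(a * x - d)\<^sup>2 / a = a * x\<^sup>2 - 2 * d * x + d\<^sup>2 / a"
        using a by (simp add: divide_simps) algebra
      also have "a * x\<^sup>2 - 2 * d * x + d\<^sup>2 / a + d * x + a * x\<^sup>2 + 4 * a * y * x
          = a * (2 * (y + x)\<^sup>2 - 2 * y\<^sup>2) + d\<^sup>2 / a - d * x"
        by algebra
      finally show ?thesis
        unfolding x_def y_def of_nat_add by linarith
    qed
    then show "\<exists>C. \<forall>k n. d * real n \<le> a * (2 * (real (k + n))\<^sup>2 - 2 * (real k)\<^sup>2) + C"
      by blast
  next
    fix m :: real
    show "\<exists>N. \<forall>k. \<exists>j\<in>{k..k+N}. 2 * (real (Suc j))\<^sup>2 - 2 * (real j)\<^sup>2 \<ge> m"
    proof (intro exI allI)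
      fix k
      have diff: "2 * (real (Suc j))\<^sup>2 - 2 * (real j)\<^sup>2 = 4 * real j + 2" for j
        by (simp add: algebra_simps power2_eq_square)
      have "m \<le> real (nat \<lceil>m\<rceil>)" by (rule real_nat_ceiling_ge)
      then have "m \<le> 4 * real (k + nat \<lceil>m\<rceil>) + 2" by simp
      then show "\<exists>j\<in>{k..k+nat \<lceil>m\<rceil>}. 2 * (real (Suc j))\<^sup>2 - 2 * (real j)\<^sup>2 \<ge> m"
        unfolding diff by (intro bexI[of _ "k + nat \<lceil>m\<rceil>"]) auto
    qed
  qed auto
next
  case False
  then have \<alpha>: "\<alpha> > 0" using assms by simp
  \<comment> \<open>The average slope \<open>d / \<alpha>\<close> is split as
    \<open>1 + 2 * \<epsilon>\<close>: the linear part \<open>1 + \<epsilon>\<close> keeps every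
    step above 1, and the remaining \<open>\<epsilon>\<close> is carried by \<open>legendre\<close>,
    which makes the jumps.\<close>
  define \<epsilon> where "\<epsilon> = (d / \<alpha> - 1) / 2"
  have \<epsilon>: "\<epsilon> > 0" using assms \<alpha> by (simp add: \<epsilon>_def)
  have d: "d = \<alpha> * (1 + 2 * \<epsilon>)" using \<alpha> by (simp add: \<epsilon>_def field_simps)
  define t where "t k = (1 + \<epsilon>) * real k + \<epsilon> * real (legendre k)" for k
  have mono: "legendre k \<le> legendre (Suc k)" for k
    using legendre_superadditive[of k 1] by simp
  show thesis
  proof (rule that[of "1 + \<epsilon>" t])
    show "t 0 = 0" by (simp add: t_def legendre_def)
    show "t (Suc k) \<ge> t k + (1 + \<epsilon>)" for k
      using \<epsilon> mono[of k] by (simp add: t_def algebra_simps)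
    show "\<alpha> * t k \<le> d * real k" for k
    proof -
      have "t k \<le> (1 + \<epsilon>) * real k + \<epsilon> * real k"
        using \<epsilon> legendre_le[of k] by (simp add: t_def)
      then have "\<alpha> * t k \<le> \<alpha> * ((1 + \<epsilon>) * real k + \<epsilon> * real k)"
        using \<alpha> by (intro mult_left_mono) auto
      then show ?thesis by (simp add: d algebra_simps)
    qed
  next
    fix a assume a: "a > \<alpha>"
    \<comment> \<open>The truncation index \<open>I\<close> is taken so large that the lost slope
      stays below the slack \<open>a * (1 + 2 * \<epsilon>) - d\<close>.\<close>
    have "(\<lambda>I. a * \<epsilon> * (1/2) ^ I) \<longlonglongrightarrow> a * \<epsilon> * 0"
      by (intro tendsto_intros) auto
    moreover have "a * \<epsilon> * 0 < (a - \<alpha>) * (1 + 2 * \<epsilon>)" using a \<epsilon> by simp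
    ultimately have "\<forall>\<^sub>F I in sequentially. a * \<epsilon> * (1/2) ^ I < (a - \<alpha>) * (1 + 2 * \<epsilon>)"
      by (rule order_tendstoD)
    then obtain I where "a * \<epsilon> * (1/2) ^ I < (a - \<alpha>) * (1 + 2 * \<epsilon>)"
      by (auto simp: eventually_sequentially)
    then have I: "d \<le> a * (1 + \<epsilon> + \<epsilon> * (1 - 1 / 2 ^ I))"
      by (simp add: d algebra_simps power_divide)
    have "d * real n \<le> a * (t (k + n) - t k) + a * \<epsilon> * real I" for k n
    proof -
      have "real (legendre k) + real (legendre n) \<le> real (legendre (k + n))"
        using legendre_superadditive[of k n] by linarith
      then have "\<epsilon> * (real (legendre k) + real n * (1 - 1 / 2 ^ I) - real I) \<le> \<epsilon> * real (legendre (k + n))"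
        using \<epsilon> legendre_ge[of n I] by (intro mult_left_mono) auto
      then have "(1 + \<epsilon> + \<epsilon> * (1 - 1 / 2 ^ I)) * real n \<le> t (k + n) - t k + \<epsilon> * real I"
        by (simp add: t_def algebra_simps)
      then have "a * ((1 + \<epsilon> + \<epsilon> * (1 - 1 / 2 ^ I)) * real n) \<le> a * (t (k + n) - t k + \<epsilon> * real I)"
        using a \<alpha> by (intro mult_left_mono) auto
      moreover have "d * real n \<le> a * (1 + \<epsilon> + \<epsilon> * (1 - 1 / 2 ^ I)) * real n"
        using I by (intro mult_right_mono) auto
      ultimately show ?thesis by (simp only: algebra_simps)
    qed
    then show "\<exists>C. \<forall>k n. d * real n \<le> a * (t (k + n) - t k) + C" by blast
  next
    fix m :: real
    define M where "M = nat \<lceil>m / \<epsilon>\<rceil>"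
    have M: "\<epsilon> * real M \<ge> m"
    proof -
      have "m / \<epsilon> \<le> real M" unfolding M_def by linarith
      then show ?thesis using \<epsilon> by (simp add: field_simps)
    qed
    have "\<exists>j\<in>{k..k+2^M}. t (Suc j) - t j \<ge> m" for k
    proof -
      \<comment> \<open>\<open>Suc j\<close> is the least multiple of \<open>2 ^ M\<close> exceeding
        \<open>k\<close>.\<close>
      define j where "j = 2 ^ M * Suc (k div 2 ^ M) - 1"
      have j: "Suc j = 2 ^ M * Suc (k div 2 ^ M)" by (simp add: j_def)
      have k: "k = 2 ^ M * (k div 2 ^ M) + k mod 2 ^ M" "k mod 2 ^ M < 2 ^ M" by auto
      have "Suc j = 2 ^ M * (k div 2 ^ M) + 2 ^ M" using j by simp
      then have "j \<in> {k..k+2^M}"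
        unfolding atLeastAtMost_iff using k by linarith
      moreover have "legendre j + M \<le> legendre (Suc j)"
        using legendre_jump[of M j] j by simp
      then have "\<epsilon> * (real (legendre j) + real M) \<le> \<epsilon> * real (legendre (Suc j))"
        using \<epsilon> by (intro mult_left_mono) (simp_all flip: of_nat_add)
      then have "t (Suc j) - t j \<ge> m"
        using M \<epsilon> by (simp add: t_def algebra_simps)
      ultimately show ?thesis by blast
    qed
    then show "\<exists>N. \<forall>k. \<exists>j\<in>{k..k+N}. t (Suc j) - t j \<ge> m" by blast
  qed (use \<epsilon> in auto)
qed

section \<open>Covering numbers and Hausdorff measure\<close>

lemma covnum_le_card:
  assumes "finite C" "C \<subseteq> F" "F \<subseteq> (\<Union>c\<in>C. cball c r)"
  shows "covnum F r \<le> card C"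
  unfolding covnum_def using assms by (intro cInf_lower) auto

text \<open>Compactness supplies a finite cover by open balls, so the infimum is that of a non-empty
  set of naturals and is attained.\<close>

lemma covnum_attained:
  assumes "compact F" "r > 0"
  obtains C where "finite C" "C \<subseteq> F" "F \<subseteq> (\<Union>c\<in>C. cball c r)" "card C = covnum F r"
proof -
  let ?S = "{card C | C. finite C \<and> C \<subseteq> F \<and> F \<subseteq> (\<Union>c\<in>C. cball c r)}"
  obtain C where "finite C" "C \<subseteq> F" "F \<subseteq> (\<Union>c\<in>C. ball c r)"
    using compactE_image[OF assms(1), of F "\<lambda>c. ball c r"] assms(2)
    by (metis UN_I centre_in_ball open_ball subsetI)
  moreover have "(\<Union>c\<in>C. ball c r) \<subseteq> (\<Union>c\<in>C. cball c r)" by (intro UN_mono) auto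
  ultimately have "card C \<in> ?S" by blast
  then have "Inf ?S \<in> ?S" by (intro Inf_nat_def1) blast
  then show thesis using that by (auto simp: covnum_def)
qed

lemma diameter_cball_le:
  fixes x :: "'a::metric_space"
  assumes "0 \<le> r"
  shows "diameter (cball x r) \<le> 2 * r"
proof -
  have "dist y z \<le> 2 * r" if "y \<in> cball x r" "z \<in> cball x r" for y z
    using that dist_triangle[of y z x] by (simp add: dist_commute)
  then show ?thesis
    using assms unfolding diameter_def by (auto intro!: cSUP_least)
qed

lemma hausdorff_pre_le_finite:
  fixes A :: "'a::metric_space set"
  assumes "finite C" "A \<subseteq> (\<Union>c\<in>C. cball c r)" "r > 0" "2 * r \<le> \<delta>" "s > 0"
  shows "hausdorff_pre s \<delta> A \<le> ennreal (real (card C) * (2 * r) powr s)"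
proof -
  obtain f where f: "bij_betw f {..<card C} C"
    using bij_betw_from_nat_into_finite[OF assms(1)] by blast
  \<comment> \<open>The finite cover is padded with empty sets, which cost nothing in
    \<open>hausdorff_pre\<close>.\<close>
  define U where "U i = (if i < card C then cball (f i) r else {})" for i
  have U: "U \<in> {U. A \<subseteq> (\<Union>i. U i) \<and> (\<forall>i. bounded (U i) \<and> diameter (U i) \<le> \<delta>)}"
  proof safe
    fix x assume "x \<in> A"
    then obtain c where c: "c \<in> C" "x \<in> cball c r" using assms(2) by auto
    have "c \<in> f ` {..<card C}" using f c(1) by (simp add: bij_betw_imp_surj_on)
    then obtain i where "i < card C" "f i = c" by blast
    then show "x \<in> (\<Union>i. U i)" using c by (auto simp: U_def)
  next
    fix i
    show "bounded (U i)" by (simp add: U_def)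
    have "diameter (cball (f i) r) \<le> 2 * r" using assms(3) by (simp add: diameter_cball_le)
    then show "diameter (U i) \<le> \<delta>" using assms by (auto simp: U_def)
  qed
  let ?g = "\<lambda>i. (if U i = {} then 0 else if s = 0 then 1 else ennreal (diameter (U i) powr s))"
  have "hausdorff_pre s \<delta> A \<le> (\<Sum>i. ?g i)"
    unfolding hausdorff_pre_def using U by (rule INF_lower)
  also have "\<dots> = (\<Sum>i<card C. ?g i)"
    by (intro suminf_finite) (auto simp: U_def)
  also have "\<dots> \<le> (\<Sum>i<card C. ennreal ((2 * r) powr s))"
  proof (intro sum_mono)
    fix i
    have "diameter (cball (f i) r) \<le> 2 * r" using assms(3) by (simp add: diameter_cball_le)
    then show "?g i \<le> ennreal ((2 * r) powr s)"
      using assms by (auto simp: U_def intro!: ennreal_leI powr_mono2 diameter_ge_0)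
  qed
  also have "\<dots> = ennreal (real (card C) * (2 * r) powr s)"
    by (simp add: ennreal_mult ennreal_of_nat_eq_real_of_nat)
  finally show ?thesis .
qed

text \<open>Refining a fixed finite cover gives of the order of \<open>r powr (- a)\<close> balls of
  radius \<open>r\<close>, of total cost at most a constant times \<open>r powr (s - a)\<close>,
  which tends to 0.\<close>

lemma hausdorff_measure_eq_0_of_assouad:
  fixes K :: "'a::metric_space set"
  assumes K: "compact K" and a: "0 < a" "a < s" and C: "C > 0"
    and cov: "\<And>r R x. 0 < r \<Longrightarrow> r \<le> R \<Longrightarrow> R < 1 \<Longrightarrow> x \<in> K \<Longrightarrow>
      real (covnum (cball x R \<inter> K) r) \<le> C * (R / r) powr a"
  shows "hausdorff_measure s K = 0"
proof -
  \<comment> \<open>The covering bound is available only for \<open>R < 1\<close>, so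
    \<open>K\<close> is first cut into finitely many pieces of radius 1/2.\<close>
  obtain D where D: "finite D" "D \<subseteq> K" "K \<subseteq> (\<Union>c\<in>D. cball c (1/2))"
    by (rule covnum_attained[OF K, of "1/2"]) auto
  define B where "B = real (card D) * C * (1/2) powr a * 2 powr s"
  have bound: "hausdorff_pre s \<delta> K \<le> ennreal (B * r powr (s - a))"
    if r: "0 < r" "r \<le> 1/2" "2 * r \<le> \<delta>" for r \<delta>
  proof -
    have "\<forall>c\<in>D. \<exists>G. finite G \<and> cball c (1/2) \<inter> K \<subseteq> (\<Union>g\<in>G. cball g r) \<and> real (card G) \<le> C * ((1/2) / r) powr a"
    proof
      fix c assume "c \<in> D"
      have "compact (cball c (1/2) \<inter> K)" using K by (intro closed_Int_compact) auto
      then obtain G where "finite G" "cball c (1/2) \<inter> K \<subseteq> (\<Union>g\<in>G. cball g r)"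
        "card G = covnum (cball c (1/2) \<inter> K) r"
        using r(1) by (rule covnum_attained)
      then show "\<exists>G. finite G \<and> cball c (1/2) \<inter> K \<subseteq> (\<Union>g\<in>G. cball g r) \<and> real (card G) \<le> C * ((1/2) / r) powr a"
        using cov[of r "1/2" c] r D \<open>c \<in> D\<close>
        by (intro exI[of _ G]) auto
    qed
    then obtain G where G: "\<And>c. c \<in> D \<Longrightarrow> finite (G c)"
      "\<And>c. c \<in> D \<Longrightarrow> cball c (1/2) \<inter> K \<subseteq> (\<Union>g\<in>G c. cball g r)"
      "\<And>c. c \<in> D \<Longrightarrow> real (card (G c)) \<le> C * ((1/2) / r) powr a"
      by metis
    let ?G = "\<Union>c\<in>D. G c"
    have "K \<subseteq> (\<Union>g\<in>?G. cball g r)"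
    proof
      fix x assume "x \<in> K"
      then obtain c where "c \<in> D" "x \<in> cball c (1/2)" using D by auto
      then show "x \<in> (\<Union>g\<in>?G. cball g r)" using G(2)[of c] \<open>x \<in> K\<close> by blast
    qed
    then have "hausdorff_pre s \<delta> K \<le> ennreal (real (card ?G) * (2 * r) powr s)"
      using G D r a by (intro hausdorff_pre_le_finite) auto
    also have "real (card ?G) * (2 * r) powr s \<le> (real (card D) * (C * ((1/2) / r) powr a)) * (2 * r) powr s"
    proof (intro mult_right_mono)
      have "real (card ?G) \<le> (\<Sum>c\<in>D. real (card (G c)))"
        using card_UN_le[OF D(1), of G] by (simp flip: of_nat_sum)
      also have "\<dots> \<le> real (card D) * (C * ((1/2) / r) powr a)"
        using sum_bounded_above[of D "\<lambda>c. real (card (G c))"] G by simp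
      finally show "real (card ?G) \<le> real (card D) * (C * ((1/2) / r) powr a)" .
    qed simp
    also have "\<dots> = B * r powr (s - a)"
      using r by (simp add: B_def powr_divide powr_mult powr_diff)
    finally show ?thesis by (simp add: ennreal_leI)
  qed
  have "hausdorff_pre s \<delta> K = 0" if \<delta>: "\<delta> > 0" for \<delta>
  proof -
    have lim: "((\<lambda>r. ennreal (B * r powr (s - a))) \<longlongrightarrow> ennreal (B * 0)) (at_right 0)"
    proof (intro tendsto_ennrealI tendsto_mult tendsto_const)
      have "((\<lambda>r::real. r powr (s - a)) \<longlongrightarrow> 0 powr (s - a)) (at_right 0)"
        by (rule tendsto_powr2) (use a in \<open>auto simp: eventually_at_right_less intro!: eventually_at_rightI[of 0 1]\<close>)
      then show "((\<lambda>r::real. r powr (s - a)) \<longlongrightarrow> 0) (at_right 0)" by simp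
    qed
    have "hausdorff_pre s \<delta> K \<le> ennreal (B * 0)"
    proof (rule tendsto_lowerbound[OF lim])
      show "\<forall>\<^sub>F r in at_right 0. hausdorff_pre s \<delta> K \<le> ennreal (B * r powr (s - a))"
        using \<delta> by (intro eventually_at_rightI[of 0 "min (1/2) (\<delta>/2)"] bound) auto
    qed auto
    then show ?thesis by simp
  qed
  then show ?thesis by (simp add: hausdorff_measure_def)
qed

lemma hausdorff_dim_le_assouad_dim:
  fixes K :: "'a::metric_space set"
  assumes "compact K"
  shows "hausdorff_dim K \<le> assouad_dim K"
  unfolding assouad_dim_def
proof (rule Inf_greatest, safe)
  fix a C :: real
  assume a: "0 < a" "0 < C" and cov: "\<forall>r R x. 0 < r \<and> r \<le> R \<and> R < 1 \<and> x \<in> K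
        \<longrightarrow> real (covnum (cball x R \<inter> K) r) \<le> C * (R / r) powr a"
  have "hausdorff_dim K \<le> ereal s" if "s > a" for s
  proof -
    have "hausdorff_measure s K = 0"
      by (rule hausdorff_measure_eq_0_of_assouad[OF assms a(1) that a(2)]) (use cov in auto)
    then show ?thesis unfolding hausdorff_dim_def using a that by (intro Inf_lower) auto
  qed
  then show "hausdorff_dim K \<le> ereal a"
    by (intro ereal_le_epsilon2[of "hausdorff_dim K" "ereal a"]) (auto)
qed

section \<open>Cantor schemes\<close>

text \<open>Such a sequence is determined by its digits on \<open>{j..<k}\<close>. If
  \<open>k < j\<close>, truncated subtraction gives the bound 1, which is still correct.\<close>

lemma card_prefix_suffix_fixed:
  fixes \<sigma> :: "nat \<Rightarrow> 'd::finite" and e :: 'd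
  shows "finite {\<omega>. (\<forall>i<j. \<omega> i = \<sigma> i) \<and> (\<forall>i\<ge>k. \<omega> i = e)}" (is "finite ?W")
    and "card {\<omega>. (\<forall>i<j. \<omega> i = \<sigma> i) \<and> (\<forall>i\<ge>k. \<omega> i = e)} \<le> CARD('d) ^ (k - j)"
proof -
  have inj: "inj_on (\<lambda>\<omega>. restrict \<omega> {j..<k}) ?W"
  proof (rule inj_onI)
    fix \<omega> \<tau> assume \<omega>: "\<omega> \<in> ?W" and \<tau>: "\<tau> \<in> ?W"
      and eq: "restrict \<omega> {j..<k} = restrict \<tau> {j..<k}"
    show "\<omega> = \<tau>"
    proof
      fix i
      consider "i < j" | "i \<ge> k" | "i \<in> {j..<k}" by fastforce
      then show "\<omega> i = \<tau> i"
      proof cases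
        case 3
        then show ?thesis using fun_cong[OF eq, of i] by simp
      qed (use \<omega> \<tau> in auto)
    qed
  qed
  have im: "(\<lambda>\<omega>. restrict \<omega> {j..<k}) ` ?W \<subseteq> {j..<k} \<rightarrow>\<^sub>E (UNIV :: 'd set)" by auto
  have fin: "finite ({j..<k} \<rightarrow>\<^sub>E (UNIV :: 'd set))" by (intro finite_PiE) auto
  show "finite ?W" using inj_on_finite[OF inj im fin] .
  show "card ?W \<le> CARD('d) ^ (k - j)"
    using card_inj_on_le[OF inj im fin] by (simp add: card_PiE)
qed

lemma card_suffix_fixed:
  fixes e :: "'d::finite"
  shows "CARD('d) ^ k \<le> card {\<omega>. \<forall>i\<ge>k. \<omega> i = e}"
proof -
  let ?W = "{\<omega>. \<forall>i\<ge>k. \<omega> i = e}"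
  have "finite ?W" using card_prefix_suffix_fixed(1)[of 0 undefined k e] by simp
  moreover have "{0..<k} \<rightarrow>\<^sub>E (UNIV :: 'd set) \<subseteq> (\<lambda>\<omega>. restrict \<omega> {0..<k}) ` ?W"
  proof
    fix f assume f: "f \<in> {0..<k} \<rightarrow>\<^sub>E (UNIV :: 'd set)"
    have "f = restrict (\<lambda>i. if i < k then f i else e) {0..<k}"
      using f by (auto simp: PiE_def extensional_def restrict_def)
    moreover have "(\<lambda>i. if i < k then f i else e) \<in> ?W" by auto
    ultimately show "f \<in> (\<lambda>\<omega>. restrict \<omega> {0..<k}) ` ?W"
      by (rule image_eqI)
  qed
  ultimately have "card ({0..<k} \<rightarrow>\<^sub>E (UNIV :: 'd set)) \<le> card ?W"
    by (rule surj_card_le)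
  then show ?thesis by (simp add: card_PiE)
qed

text \<open>\<open>\<pi>\<close> is bi-Lipschitz for the ultrametric on digit sequences in which two sequences
  with first disagreement at \<open>k\<close> have distance \<open>L k\<close>.\<close>

locale cantor_scheme =
  fixes \<pi> :: "(nat \<Rightarrow> 'd::finite) \<Rightarrow> 'a::metric_space"
    and L :: "nat \<Rightarrow> real" and M \<eta> :: real
  assumes scale_pos: "\<And>k. L k > 0"
    and scale_decseq: "decseq L"
    and scale_lim: "L \<longlonglongrightarrow> 0"
    and scale_0: "L 0 = 1"
    and M_pos: "M > 0"
    and \<eta>_pos: "\<eta> > 0"
    and dist_le: "\<And>\<sigma> \<tau> k. (\<And>i. i < k \<Longrightarrow> \<sigma> i = \<tau> i) \<Longrightarrow> dist (\<pi> \<sigma>) (\<pi> \<tau>) \<le> M * L k"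
    and dist_ge: "\<And>\<sigma> \<tau> k. (\<And>i. i < k \<Longrightarrow> \<sigma> i = \<tau> i) \<Longrightarrow> \<sigma> k \<noteq> \<tau> k \<Longrightarrow> \<eta> * L k \<le> dist (\<pi> \<sigma>) (\<pi> \<tau>)"
begin

lemma scale_mono: "j \<le> k \<Longrightarrow> L k \<le> L j"
  using scale_decseq by (rule decseqD)

text \<open>Apply \<open>dist_ge\<close> at the first disagreement; an earlier one would separate
  the points even further.\<close>

lemma agree_of_dist_less:
  assumes "dist (\<pi> \<sigma>) (\<pi> \<tau>) < \<eta> * L k" "i \<le> k"
  shows "\<sigma> i = \<tau> i"
proof (rule ccontr)
  assume ne: "\<sigma> i \<noteq> \<tau> i"
  define j where "j = (LEAST j. \<sigma> j \<noteq> \<tau> j)"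
  have "\<sigma> j \<noteq> \<tau> j" "j \<le> i" "\<And>l. l < j \<Longrightarrow> \<sigma> l = \<tau> l"
    unfolding j_def using LeastI[of "\<lambda>j. \<sigma> j \<noteq> \<tau> j", OF ne] Least_le[of "\<lambda>j. \<sigma> j \<noteq> \<tau> j", OF ne]
      not_less_Least by blast+
  then have "\<eta> * L j \<le> dist (\<pi> \<sigma>) (\<pi> \<tau>)" by (intro dist_ge)
  moreover have "\<eta> * L k \<le> \<eta> * L j"
    using scale_mono[of j k] \<open>j \<le> i\<close> assms(2) \<eta>_pos by simp
  ultimately show False using assms(1) by linarith
qed

text \<open>Translates a radius into a level: since \<open>L\<close> tends to 0 there is a least
  level with the first property.\<close>

lemma exists_scale:
  assumes "\<rho> > 0"
  obtains j where "c * L j \<le> \<rho>" "\<And>i. i < j \<Longrightarrow> c * L i > \<rho>"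
proof -
  have "(\<lambda>j. c * L j) \<longlonglongrightarrow> c * 0" by (intro tendsto_intros scale_lim)
  then have "\<forall>\<^sub>F j in sequentially. c * L j < \<rho>" using assms by (intro order_tendstoD) auto
  then obtain j where "c * L j < \<rho>" by (auto simp: eventually_sequentially)
  then have j: "c * L j \<le> \<rho>" by simp
  show thesis
    using that[of "LEAST j. c * L j \<le> \<rho>"] LeastI[of "\<lambda>j. c * L j \<le> \<rho>", OF j]
      not_less_Least[of _ "\<lambda>j. c * L j \<le> \<rho>"] by (meson not_le)
qed

text \<open>Digits of a Cauchy sequence stabilise one by one, which gives completeness; truncated
  addresses form finite nets.\<close>

lemma compact_range: "compact (range \<pi>)"
proof (rule compact_eq_totally_bounded[THEN iffD2], intro conjI allI impI)
  show "complete (range \<pi>)"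
    unfolding complete_def
  proof (intro allI impI, elim conjE)
    fix f assume f: "\<forall>n. f n \<in> range \<pi>" and C: "Cauchy f"
    define w where "w n = inv \<pi> (f n)" for n
    have w: "f n = \<pi> (w n)" for n
      using f by (simp add: w_def f_inv_into_f)
    have "\<exists>N. \<forall>n\<ge>N. \<forall>i\<le>k. w n i = w N i" for k
    proof -
      have "\<eta> * L k > 0" using \<eta>_pos scale_pos by simp
      then obtain N where N: "\<And>m n. m \<ge> N \<Longrightarrow> n \<ge> N \<Longrightarrow> dist (f m) (f n) < \<eta> * L k"
        using metric_CauchyD[OF C] by metis
      have "w n i = w N i" if "n \<ge> N" "i \<le> k" for n i
        using agree_of_dist_less[of "w n" "w N" k i] N[of n N] that by (simp add: w)
      then show ?thesis by blast
    qed
    then obtain N where N: "\<And>k n i. n \<ge> N k \<Longrightarrow> i \<le> k \<Longrightarrow> w n i = w (N k) i" by metis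
    \<comment> \<open>The limit address takes the eventual value of each digit.\<close>
    define \<omega> where "\<omega> i = w (N i) i" for i
    have agree: "w n i = \<omega> i" if "n \<ge> N k" "i \<le> k" for n k i
      using N[of k "max (N i) (N k)" i] N[of i "max (N i) (N k)" i] N[of k n i] that
      by (simp add: \<omega>_def)
    have "f \<longlonglongrightarrow> \<pi> \<omega>"
    proof (rule metric_LIMSEQ_I)
      fix e :: real assume "e > 0"
      then obtain k where k: "M * L k \<le> e / 2" using exists_scale[of "e/2" M] by auto
      have "dist (f n) (\<pi> \<omega>) < e" if "n \<ge> N k" for n
      proof -
        have "dist (f n) (\<pi> \<omega>) \<le> M * L k"
          unfolding w using agree that by (intro dist_le) auto
        then show ?thesis using k \<open>e > 0\<close> by linarith
      qed
      then show "\<exists>N. \<forall>n\<ge>N. dist (f n) (\<pi> \<omega>) < e" by blast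
    qed
    then show "\<exists>l\<in>range \<pi>. f \<longlonglongrightarrow> l" by blast
  qed
next
  fix e :: real assume "e > 0"
  then obtain k where k: "M * L k \<le> e / 2" using exists_scale[of "e/2" M] by auto
  fix c :: 'd
  let ?W = "{\<omega>::nat \<Rightarrow> 'd. \<forall>i\<ge>k. \<omega> i = c}"
  have "finite ?W" using card_prefix_suffix_fixed(1)[of 0 undefined k c] by simp
  moreover have "range \<pi> \<subseteq> (\<Union>x\<in>\<pi> ` ?W. ball x e)"
  proof safe
    fix \<omega>
    let ?\<omega> = "\<lambda>i. if i < k then \<omega> i else c"
    have "dist (\<pi> ?\<omega>) (\<pi> \<omega>) \<le> M * L k" by (intro dist_le) auto
    then have "\<pi> \<omega> \<in> ball (\<pi> ?\<omega>) e" using k \<open>e > 0\<close> by simp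
    moreover have "?\<omega> \<in> ?W" by simp
    ultimately show "\<pi> \<omega> \<in> (\<Union>x\<in>\<pi> ` ?W. ball x e)" by blast
  qed
  ultimately show "\<exists>k. finite k \<and> range \<pi> \<subseteq> (\<Union>x\<in>k. ball x e)" by blast
qed

section \<open>Upper bounds for covering numbers and the Assouad dimension\<close>

text \<open>Points of the ball share their first \<open>k\<close> digits, and digits from
  \<open>m\<close> on are invisible at resolution \<open>r\<close>; only the digits in between are
  counted.\<close>

lemma covnum_le:
  assumes "\<And>i. i < k \<Longrightarrow> R < \<eta> * L i" "M * L m \<le> r" "x \<in> range \<pi>"
  shows "covnum (cball x R \<inter> range \<pi>) r \<le> CARD('d) ^ (m - k)"
proof -
  obtain \<sigma> where x: "x = \<pi> \<sigma>" using assms(3) by blast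
  fix e :: 'd
  let ?W = "{\<omega>. (\<forall>i<k. \<omega> i = \<sigma> i) \<and> (\<forall>i\<ge>max k m. \<omega> i = e)}"
  let ?B = "cball x R \<inter> range \<pi>"
  \<comment> \<open>Cutting at \<open>max k m\<close> never overwrites the common prefix, even when
    \<open>m < k\<close>.\<close>
  let ?cut = "\<lambda>\<omega> i. if i < max k m then \<omega> i else e"
  let ?A = "{\<omega>. \<pi> \<omega> \<in> ?B}"
  have cut: "?cut ` ?A \<subseteq> ?W"
  proof safe
    fix \<omega> i assume "\<pi> \<omega> \<in> cball x R" and i: "i < k"
    then have "dist (\<pi> \<omega>) (\<pi> \<sigma>) < \<eta> * L i"
      using assms(1)[OF i] by (simp add: x dist_commute)
    then show "?cut \<omega> i = \<sigma> i" using agree_of_dist_less[of \<omega> \<sigma> i i] i by (simp add: less_max_iff_disj)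
  qed auto
  \<comment> \<open>The centres counted by \<open>covnum\<close> must lie in the covered set, but
    the point with the truncated address may leave the ball; so each truncated word gets a
    representative inside.\<close>
  define g where "g w = (SOME \<omega>. \<omega> \<in> ?A \<and> ?cut \<omega> = w)" for w
  have g: "g (?cut \<omega>) \<in> ?A \<and> ?cut (g (?cut \<omega>)) = ?cut \<omega>" if "\<omega> \<in> ?A" for \<omega>
    unfolding g_def by (rule someI[of _ \<omega>]) (use that in simp)
  let ?C = "(\<lambda>w. \<pi> (g w)) ` ?cut ` ?A"
  have finW: "finite ?W" by (rule card_prefix_suffix_fixed(1))
  then have fin: "finite (?cut ` ?A)" using cut finite_subset by blast
  have "covnum ?B r \<le> card ?C"
  proof (rule covnum_le_card)
    show "finite ?C" using fin by blast
    show "?C \<subseteq> ?B" using g by blast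
    show "?B \<subseteq> (\<Union>c\<in>?C. cball c r)"
    proof
      fix y assume y: "y \<in> ?B"
      then obtain \<omega> where \<omega>: "y = \<pi> \<omega>" "\<omega> \<in> ?A" by blast
      have "dist (\<pi> (g (?cut \<omega>))) (\<pi> \<omega>) \<le> M * L m"
      proof (rule dist_le)
        fix i assume "i < m"
        then show "g (?cut \<omega>) i = \<omega> i"
          using conjunct2[OF g[OF \<omega>(2)], THEN fun_cong, of i] by (simp split: if_splits)
      qed
      then have "y \<in> cball (\<pi> (g (?cut \<omega>))) r" using assms(2) \<omega> by simp
      then show "y \<in> (\<Union>c\<in>?C. cball c r)" using \<omega> by blast
    qed
  qed
  also have "card ?C \<le> card (?cut ` ?A)" by (rule card_image_le[OF fin])
  also have "\<dots> \<le> card ?W" by (rule card_mono[OF finW cut])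
  also have "\<dots> \<le> CARD('d) ^ (max k m - k)" by (rule card_prefix_suffix_fixed(2))
  also have "max k m - k = m - k" by simp
  finally show ?thesis .
qed

lemma assouad_bound:
  assumes "a \<ge> 0" "C0 > 0"
    and growth: "\<And>k n. real CARD('d) ^ n \<le> C0 * (L k / L (k + n)) powr a"
  shows "\<exists>C>0. \<forall>r R x. 0 < r \<and> r \<le> R \<and> R < 1 \<and> x \<in> range \<pi>
        \<longrightarrow> real (covnum (cball x R \<inter> range \<pi>) r) \<le> C * (R / r) powr a"
proof -
  define q where "q = real CARD('d)"
  have q: "q \<ge> 1" by (simp add: q_def Suc_leI)
  \<comment> \<open>The factor \<open>q\<close> pays for one digit lost below, \<open>C0\<close>
    comes from the growth hypothesis and \<open>(M / \<eta>) powr a\<close> from the bi-Lipschitz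
    constants. The extra 1 in the final constant handles \<open>m \<le> k\<close>.\<close>
  define B where "B = q * C0 * (M / \<eta>) powr a"
  have "real (covnum (cball x R \<inter> range \<pi>) r) \<le> (1 + B) * (R / r) powr a"
    if r: "0 < r" "r \<le> R" and x: "x \<in> range \<pi>" for r R x
  proof -
    obtain k where k: "\<eta> * L k \<le> R" "\<And>i. i < k \<Longrightarrow> \<eta> * L i > R"
      using exists_scale[of R \<eta>] r by auto
    obtain m where m: "M * L m \<le> r" "\<And>i. i < m \<Longrightarrow> M * L i > r"
      using exists_scale[of r M] r by auto
    have "1 \<le> (R / r) powr a" using r assms by (intro ge_one_powr_ge_zero) auto
    have "real (covnum (cball x R \<inter> range \<pi>) r) \<le> real (CARD('d) ^ (m - k))"
      unfolding of_nat_le_iff by (rule covnum_le[OF _ m(1) x]) (rule k(2))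
    then have cov: "real (covnum (cball x R \<inter> range \<pi>) r) \<le> q ^ (m - k)" by (simp add: q_def)
    show ?thesis
    proof (cases "m \<le> k")
      case True
      have "B \<ge> 0" using q assms by (simp add: B_def)
      have "1 \<le> (1 + B) * (R / r) powr a"
        using mult_mono[of 1 "1 + B" 1 "(R / r) powr a"] \<open>B \<ge> 0\<close> \<open>1 \<le> (R / r) powr a\<close> by simp
      then show ?thesis using cov True by simp
    next
      case False
      \<comment> \<open>Minimality of \<open>m\<close> bounds \<open>L\<close> from below only at
        \<open>m - 1\<close>, hence the shift by one.\<close>
      define n where "n = m - 1 - k"
      have n: "m - k = Suc n" "k + n = m - 1" "m - 1 < m" using False by (auto simp: n_def)
      have "L k / L (k + n) \<le> (R / \<eta>) / (r / M)"
      proof (rule frac_le)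
        show "L k \<le> R / \<eta>" using k(1) \<eta>_pos by (simp add: field_simps)
        show "r / M \<le> L (k + n)" using m(2)[OF n(3)] M_pos n(2) by (simp add: field_simps)
      qed (use r \<eta>_pos M_pos in auto)
      then have "(L k / L (k + n)) powr a \<le> ((R / \<eta>) / (r / M)) powr a"
        using assms scale_pos by (intro powr_mono2) (auto intro: less_imp_le divide_nonneg_nonneg)
      also have "(R / \<eta>) / (r / M) = (M / \<eta>) * (R / r)" by simp
      also have "\<dots> powr a = (M / \<eta>) powr a * (R / r) powr a"
        using r M_pos \<eta>_pos by (intro powr_mult)
      finally have "C0 * (L k / L (k + n)) powr a \<le> C0 * ((M / \<eta>) powr a * (R / r) powr a)"
        using assms by simp
      then have "q ^ n \<le> C0 * ((M / \<eta>) powr a * (R / r) powr a)"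
        using growth[of n k] by (simp add: q_def)
      then have "q ^ Suc n \<le> q * (C0 * ((M / \<eta>) powr a * (R / r) powr a))"
        using q by simp
      also have "\<dots> = B * (R / r) powr a" by (simp add: B_def)
      also have "\<dots> \<le> (1 + B) * (R / r) powr a" by (intro mult_right_mono) auto
      finally show ?thesis using cov n(1) by simp
    qed
  qed
  moreover have "1 + B > 0" using q assms by (simp add: B_def add_pos_nonneg)
  ultimately show ?thesis by blast
qed

section \<open>Lower bound for the Hausdorff dimension\<close>

text \<open>All addresses of points in the ball share a prefix of length \<open>j\<close>, where
  \<open>\<eta> * L j\<close> is at most \<open>2 * \<rho>\<close>; so at most a fraction
  \<open>(1 / real CARD('d)) ^ j\<close> of the level-\<open>k\<close> words is counted, and
  \<open>mass\<close> bounds it.\<close>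

lemma card_ball_le:
  assumes "a \<ge> 0" and mass: "\<And>j. (1 / real CARD('d)) ^ j \<le> L j powr a" and \<rho>: "\<rho> > 0"
  obtains j where "\<And>k e. k \<ge> j \<Longrightarrow>
    real (card {\<omega>. (\<forall>i\<ge>k. \<omega> i = e) \<and> \<pi> \<omega> \<in> ball x \<rho>})
      \<le> (2 / \<eta>) powr a * \<rho> powr a * real CARD('d) ^ k"
proof -
  \<comment> \<open>The centre \<open>x\<close> may lie outside the range, so two points of the ball
    are compared with each other; hence the factor 2.\<close>
  obtain j where j: "\<eta> * L j \<le> 2 * \<rho>" "\<And>i. i < j \<Longrightarrow> \<eta> * L i > 2 * \<rho>"
    using exists_scale[of "2 * \<rho>" \<eta>] \<rho> by auto
  show thesis
  proof (rule that)
    fix k e assume k: "k \<ge> j"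
    let ?A = "{\<omega>. (\<forall>i\<ge>k. \<omega> i = e) \<and> \<pi> \<omega> \<in> ball x \<rho>}"
    have "real (card ?A) \<le> real CARD('d) ^ (k - j)"
    proof (cases "?A = {}")
      case False
      then obtain \<sigma> where \<sigma>: "\<pi> \<sigma> \<in> ball x \<rho>" by blast
      have "?A \<subseteq> {\<omega>. (\<forall>i<j. \<omega> i = \<sigma> i) \<and> (\<forall>i\<ge>k. \<omega> i = e)}"
      proof safe
        fix \<omega> i assume "\<pi> \<omega> \<in> ball x \<rho>" "i < j"
        have "dist (\<pi> \<omega>) (\<pi> \<sigma>) < 2 * \<rho>"
          using \<sigma> \<open>\<pi> \<omega> \<in> ball x \<rho>\<close> dist_triangle2[of "\<pi> \<omega>" "\<pi> \<sigma>" x]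
          by (simp add: dist_commute)
        also have "\<dots> < \<eta> * L i" using j(2) \<open>i < j\<close> .
        finally show "\<omega> i = \<sigma> i" using agree_of_dist_less[of \<omega> \<sigma> i i] by simp
      qed
      then have "card ?A \<le> card {\<omega>. (\<forall>i<j. \<omega> i = \<sigma> i) \<and> (\<forall>i\<ge>k. \<omega> i = e)}"
        by (intro card_mono card_prefix_suffix_fixed(1))
      also have "\<dots> \<le> CARD('d) ^ (k - j)" by (rule card_prefix_suffix_fixed(2))
      finally show ?thesis by (simp flip: of_nat_power)
    next
      case True
      show ?thesis unfolding True by simp
    qed
    also have "\<dots> = (1 / real CARD('d)) ^ j * real CARD('d) ^ k"
      using k by (simp add: power_diff power_divide)
    also have "\<dots> \<le> (2 / \<eta>) powr a * \<rho> powr a * real CARD('d) ^ k"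
    proof (rule mult_right_mono)
      have "(1 / real CARD('d)) ^ j \<le> L j powr a" by (rule mass)
      also have "\<dots> \<le> (2 / \<eta> * \<rho>) powr a"
        using j(1) \<eta>_pos assms scale_pos[of j] by (intro powr_mono2) (auto simp: field_simps)
      also have "\<dots> = (2 / \<eta>) powr a * \<rho> powr a"
        using \<eta>_pos \<rho> by (intro powr_mult)
      finally show "(1 / real CARD('d)) ^ j \<le> (2 / \<eta>) powr a * \<rho> powr a" .
    qed simp
    finally show "real (card ?A) \<le> (2 / \<eta>) powr a * \<rho> powr a * real CARD('d) ^ k" .
  qed
qed

text \<open>Counting the level-\<open>k\<close> addresses, for \<open>k\<close> large, replaces the mass distribution
  principle; compactness of the range makes a single \<open>k\<close> suffice.\<close>

lemma sum_radii_ge: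
  fixes x :: "nat \<Rightarrow> 'a" and \<rho> :: "nat \<Rightarrow> real"
  assumes "a \<ge> 0" and mass: "\<And>j. (1 / real CARD('d)) ^ j \<le> L j powr a"
    and \<rho>: "\<And>i. \<rho> i > 0" and cover: "range \<pi> \<subseteq> (\<Union>i. ball (x i) (\<rho> i))"
  obtains I where "finite I" "1 \<le> (2 / \<eta>) powr a * (\<Sum>i\<in>I. \<rho> i powr a)"
proof -
  obtain I where I: "finite I" "range \<pi> \<subseteq> (\<Union>i\<in>I. ball (x i) (\<rho> i))"
    using compactE_image[OF compact_range, of UNIV "\<lambda>i. ball (x i) (\<rho> i)"] cover by auto
  define small where "small i k \<longleftrightarrow> (\<forall>e. real (card {\<omega>. (\<forall>i\<ge>k. \<omega> i = e) \<and> \<pi> \<omega> \<in> ball (x i) (\<rho> i)})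
      \<le> (2 / \<eta>) powr a * \<rho> i powr a * real CARD('d) ^ k)" for i k
  have "\<exists>j. \<forall>k\<ge>j. small i k" for i
  proof (rule card_ball_le[OF assms(1) mass \<rho>[of i], of "x i"])
    fix j
    assume "\<And>k e. k \<ge> j \<Longrightarrow> real (card {\<omega>. (\<forall>i\<ge>k. \<omega> i = e) \<and> \<pi> \<omega> \<in> ball (x i) (\<rho> i)})
      \<le> (2 / \<eta>) powr a * \<rho> i powr a * real CARD('d) ^ k"
    then have "\<forall>k\<ge>j. small i k" unfolding small_def by simp
    then show ?thesis by blast
  qed
  then obtain j where j: "\<And>i k. k \<ge> j i \<Longrightarrow> small i k"
    by metis
  \<comment> \<open>The sum is just a level above every \<open>j i\<close> with
    \<open>i \<in> I\<close>.\<close>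
  define k where "k = (\<Sum>i\<in>I. j i)"
  have k: "j i \<le> k" if "i \<in> I" for i
    unfolding k_def using I(1) that by (intro member_le_sum) auto
  fix e :: 'd
  let ?A = "\<lambda>i. {\<omega>. (\<forall>i\<ge>k. \<omega> i = e) \<and> \<pi> \<omega> \<in> ball (x i) (\<rho> i)}"
  have "real CARD('d) ^ k \<le> real (card {\<omega>. \<forall>i\<ge>k. \<omega> i = e})"
    using card_suffix_fixed[of k e] by (simp flip: of_nat_power)
  also have "{\<omega>. \<forall>i\<ge>k. \<omega> i = e} = (\<Union>i\<in>I. ?A i)" using I(2) by blast
  also have "real (card \<dots>) \<le> (\<Sum>i\<in>I. real (card (?A i)))"
    using card_UN_le[OF I(1), of ?A] by (simp flip: of_nat_sum)
  also have "\<dots> \<le> (\<Sum>i\<in>I. (2 / \<eta>) powr a * \<rho> i powr a * real CARD('d) ^ k)"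
    using j[OF k] unfolding small_def by (intro sum_mono) blast
  also have "\<dots> = ((2 / \<eta>) powr a * (\<Sum>i\<in>I. \<rho> i powr a)) * real CARD('d) ^ k"
    by (simp add: sum_distrib_left sum_distrib_right)
  finally have "1 \<le> (2 / \<eta>) powr a * (\<Sum>i\<in>I. \<rho> i powr a)" by simp
  then show thesis using that I(1) by blast
qed

text \<open>A cover of tiny cost is fattened to open balls with radii slightly above the diameters,
  contradicting \<open>sum_radii_ge\<close>.\<close>

lemma hausdorff_measure_neq_0:
  assumes "0 \<le> s" "s \<le> a"
    and mass: "\<And>j. (1 / real CARD('d)) ^ j \<le> L j powr a"
  shows "hausdorff_measure s (range \<pi>) \<noteq> 0"
proof
  assume 0: "hausdorff_measure s (range \<pi>) = 0"
  \<comment> \<open>Diameters and fattening errors each contribute at most \<open>c\<close>; this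
    value makes the final total 1/2.\<close>
  define c where "c = 1 / (4 * (2 / \<eta>) powr a)"
  have \<eta>a: "(2 / \<eta>) powr a > 0" using \<eta>_pos by simp
  then have c: "c > 0" by (simp add: c_def)
  let ?g = "\<lambda>U i. if U i = {} then 0 else if s = 0 then 1 else ennreal (diameter (U i) powr s)"
  have "hausdorff_pre s (1/2) (range \<pi>) \<le> hausdorff_measure s (range \<pi>)"
    unfolding hausdorff_measure_def by (rule SUP_upper) simp
  \<comment> \<open>The bound 1 serves the case \<open>s = 0\<close>, where each non-empty set costs
    1.\<close>
  then have "hausdorff_pre s (1/2) (range \<pi>) < ennreal (min c 1)" using 0 c by simp
  then obtain U :: "nat \<Rightarrow> 'a set" where U: "range \<pi> \<subseteq> (\<Union>i. U i)" "\<And>i. bounded (U i)"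
    "\<And>i. diameter (U i) \<le> 1/2" and sum: "(\<Sum>i. ?g U i) < ennreal (min c 1)"
    unfolding hausdorff_pre_def INF_less_iff by auto
  show False
  proof (cases "s = 0")
    case True
    have "\<pi> undefined \<in> (\<Union>i. U i)" using U(1) by blast
    then obtain i where i: "U i \<noteq> {}" by blast
    have "1 = (\<Sum>i\<in>{i}. ?g U i)" using True i by simp
    also have "\<dots> \<le> (\<Sum>i. ?g U i)" by (rule sum_le_suminf) auto
    also have "\<dots> < ennreal (min c 1)" by (rule sum)
    also have "\<dots> \<le> ennreal 1" by (rule ennreal_leI) simp
    finally show False by simp
  next
    case False
    then have s: "s > 0" using assms by simp
    define e where "e i = c * (1/2) ^ Suc i" for i :: nat
    have e: "e i > 0" for i using c by (simp add: e_def)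
    \<comment> \<open>A radius strictly above the diameter makes an open ball swallow
      \<open>U i\<close>, even a singleton; staying below 1 gives
      \<open>\<rho> powr a \<le> \<rho> powr s\<close>.\<close>
    have "\<exists>\<rho>. diameter (U i) < \<rho> \<and> \<rho> < 1 \<and> \<rho> powr s < diameter (U i) powr s + e i" for i
    proof -
      have "((\<lambda>\<rho>. \<rho> powr s) \<longlongrightarrow> diameter (U i) powr s) (at_right (diameter (U i)))"
      proof (rule tendsto_powr2)
        show "\<forall>\<^sub>F x in at_right (diameter (U i)). 0 \<le> x"
          using diameter_ge_0[OF U(2)[of i]] by (intro eventually_at_rightI[of _ "diameter (U i) + 1"]) auto
      qed (use s in auto)
      then have "\<forall>\<^sub>F \<rho> in at_right (diameter (U i)). \<rho> powr s < diameter (U i) powr s + e i"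
        using e[of i] by (intro order_tendstoD) auto
      moreover have "\<forall>\<^sub>F \<rho> in at_right (diameter (U i)). diameter (U i) < \<rho> \<and> \<rho> < 1"
        using U(3)[of i] by (intro eventually_at_rightI[of _ 1]) auto
      ultimately have "\<forall>\<^sub>F \<rho> in at_right (diameter (U i)).
          diameter (U i) < \<rho> \<and> \<rho> < 1 \<and> \<rho> powr s < diameter (U i) powr s + e i"
        by eventually_elim simp
      then show ?thesis using eventually_happens trivial_limit_at_right_real by blast
    qed
    then obtain \<rho> where \<rho>: "\<And>i. diameter (U i) < \<rho> i" "\<And>i. \<rho> i < 1"
      "\<And>i. \<rho> i powr s < diameter (U i) powr s + e i" by metis
    have \<rho>0: "\<rho> i > 0" for i
      using diameter_ge_0[OF U(2)[of i]] \<rho>(1)[of i] by linarith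
    define x where "x i = (SOME x. x \<in> U i)" for i
    have cover: "range \<pi> \<subseteq> (\<Union>i. ball (x i) (\<rho> i))"
    proof
      fix y assume "y \<in> range \<pi>"
      then obtain i where i: "y \<in> U i" using U(1) by blast
      then have "x i \<in> U i" unfolding x_def by (rule someI)
      then have "dist (x i) y \<le> diameter (U i)" using i U(2) by (intro diameter_bounded_bound)
      then show "y \<in> (\<Union>i. ball (x i) (\<rho> i))" using \<rho>(1)[of i]
        by (intro UN_I[of i]) auto
    qed
    obtain I where I: "finite I" "1 \<le> (2 / \<eta>) powr a * (\<Sum>i\<in>I. \<rho> i powr a)"
      using order_trans[OF assms(1,2)] by (rule sum_radii_ge[OF _ mass \<rho>0 cover])
    have "ennreal (\<Sum>i\<in>I. diameter (U i) powr s) = (\<Sum>i\<in>I. ennreal (diameter (U i) powr s))"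
      by (rule sum_ennreal[symmetric]) simp
    also have "\<dots> = (\<Sum>i\<in>I. ?g U i)"
      by (intro sum.cong) (use s in \<open>auto simp: diameter_def\<close>)
    also have "\<dots> \<le> (\<Sum>i. ?g U i)" by (rule sum_le_suminf) (use I in auto)
    also have "\<dots> \<le> ennreal (min c 1)" using sum by (rule less_imp_le)
    also have "\<dots> \<le> ennreal c" by (rule ennreal_leI) simp
    finally have diam: "(\<Sum>i\<in>I. diameter (U i) powr s) \<le> c" using c by (simp add: ennreal_le_iff)
    have "e sums c"
      using sums_mult[OF power_half_series, of c] unfolding e_def by simp
    then have "summable e" "suminf e = c" by (simp_all add: sums_iff)
    then have eI: "(\<Sum>i\<in>I. e i) \<le> c"
      using sum_le_suminf[of e I] I e by (auto intro: less_imp_le)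
    have "(\<Sum>i\<in>I. \<rho> i powr a) \<le> (\<Sum>i\<in>I. diameter (U i) powr s + e i)"
    proof (rule sum_mono)
      fix i
      have "\<rho> i powr a \<le> \<rho> i powr s" using assms \<rho>0[of i] \<rho>(2)[of i] by (intro powr_mono') auto
      then show "\<rho> i powr a \<le> diameter (U i) powr s + e i" using \<rho>(3)[of i] by linarith
    qed
    also have "\<dots> \<le> 2 * c" using diam eI by (simp add: sum.distrib)
    finally have "(2 / \<eta>) powr a * (\<Sum>i\<in>I. \<rho> i powr a) \<le> (2 / \<eta>) powr a * (2 * c)"
      using \<eta>a by (intro mult_left_mono) auto
    also have "\<dots> = 1/2" using \<eta>a \<eta>_pos by (simp add: c_def)
    finally show False using I(2) by simp
  qed
qed

lemma hausdorff_dim_ge: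
  assumes mass: "\<And>j. (1 / real CARD('d)) ^ j \<le> L j powr a"
  shows "hausdorff_dim (range \<pi>) \<ge> ereal a"
  unfolding hausdorff_dim_def
proof (rule Inf_greatest, safe)
  fix s :: real assume "s \<ge> 0" "hausdorff_measure s (range \<pi>) = 0"
  then show "ereal a \<le> ereal s"
    using hausdorff_measure_neq_0[OF _ _ mass, of s] by (meson ereal_less_eq(3) linear)
qed

text \<open>The lower bound \<open>g0\<close> must not depend on the magnification \<open>lam\<close>, since the gap has to
  survive the passage to a limit of minisets. As gaps are unbounded, \<open>lam * L k\<close> may skip far
  below \<open>R0\<close> in a single step; truncating it at \<open>R0\<close> turns such a step into a usable gap.\<close>

lemma exists_gap_scale:
  assumes B: "B > 1" and R0: "0 < R0" "R0 \<le> 1"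
    and gaps: "\<And>B. \<exists>N. \<forall>k. \<exists>j\<in>{k..k+N}. L (Suc j) * B \<le> L j"
  shows "\<exists>g0>0. \<forall>lam\<ge>1. \<exists>k g. g0 \<le> g \<and> g \<le> R0 \<and> g \<le> lam * L k \<and> lam * L (Suc k) * B \<le> g"
proof -
  obtain N where N: "\<And>k. \<exists>j\<in>{k..k+N}. L (Suc j) * B \<le> L j" using gaps by blast
  have "\<exists>k g. R0 / B ^ Suc N \<le> g \<and> g \<le> R0 \<and> g \<le> lam * L k \<and> lam * L (Suc k) * B \<le> g"
    if lam: "lam \<ge> 1" for lam
  proof -
    define g where "g k = min R0 (lam * L k)" for k
    obtain j where j: "lam * L j \<le> R0" "\<And>i. i < j \<Longrightarrow> lam * L i > R0"
      using exists_scale[of R0 lam] R0 by auto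
    \<comment> \<open>The last level before truncation ends; for \<open>j = 0\<close> it is 0, where
      \<open>lam * L 0 \<ge> 1 \<ge> R0\<close>.\<close>
    define k0 where "k0 = j - 1"
    have g_k0: "g k0 = R0"
    proof (cases "j = 0")
      case True
      then show ?thesis using lam R0 scale_0 by (simp add: g_def k0_def)
    next
      case False
      then show ?thesis using j(2)[of k0] by (simp add: g_def k0_def)
    qed
    \<comment> \<open>Searching from \<open>Suc k0\<close> puts \<open>k1\<close> beyond the
      truncated levels, so this gap of \<open>L\<close> is also a gap of \<open>g\<close>.\<close>
    obtain k1 where k1: "k1 \<in> {Suc k0..Suc k0 + N}" "L (Suc k1) * B \<le> L k1" using N by blast
    have "j \<le> k1" using k1 by (auto simp: k0_def)
    then have "lam * L k1 \<le> lam * L j" using scale_mono[of j k1] lam by (intro mult_left_mono) auto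
    then have "g k1 = lam * L k1" using j(1) by (simp add: g_def)
    moreover have "g (Suc k1) * B \<le> lam * L (Suc k1) * B" using B by (intro mult_right_mono) (auto simp: g_def)
    moreover have "lam * (L (Suc k1) * B) \<le> lam * L k1" using k1 lam by (intro mult_left_mono) auto
    ultimately have g_k1: "g (Suc (k0 + (k1 - k0))) * B \<le> g (k0 + (k1 - k0))" using k1(1) by (simp add: mult.assoc)
    \<comment> \<open>Before the first gap of \<open>g\<close> each step loses less than a factor
      \<open>B\<close>, so \<open>g\<close> has not fallen below \<open>R0 / B ^ m\<close>.\<close>
    define m where "m = (LEAST m. g (Suc (k0 + m)) * B \<le> g (k0 + m))"
    have m: "g (Suc (k0 + m)) * B \<le> g (k0 + m)"
      unfolding m_def by (rule LeastI[of "\<lambda>m. g (Suc (k0 + m)) * B \<le> g (k0 + m)", OF g_k1])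
    have "m \<le> k1 - k0"
      unfolding m_def by (rule Least_le[of "\<lambda>m. g (Suc (k0 + m)) * B \<le> g (k0 + m)", OF g_k1])
    then have "m \<le> Suc N" using k1(1) by auto
    have "i \<le> m \<Longrightarrow> g (k0 + i) * B ^ i \<ge> R0" for i
    proof (induction i)
      case (Suc i)
      have "\<not> g (Suc (k0 + i)) * B \<le> g (k0 + i)"
        using Suc.prems unfolding m_def by (intro not_less_Least) simp
      then have "g (k0 + i) * B ^ i \<le> g (Suc (k0 + i)) * B * B ^ i"
        using B by (intro mult_right_mono) auto
      then show ?case using Suc by (simp add: mult_ac)
    qed (simp add: g_k0)
    then have "R0 \<le> g (k0 + m) * B ^ m" by simp
    also have "\<dots> \<le> g (k0 + m) * B ^ Suc N"
    proof (rule mult_left_mono)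
      show "B ^ m \<le> B ^ Suc N" using B \<open>m \<le> Suc N\<close> by (intro power_increasing) auto
      show "0 \<le> g (k0 + m)" using R0 lam scale_pos[of "k0 + m"] by (simp add: g_def)
    qed
    finally have "R0 / B ^ Suc N \<le> g (k0 + m)" using B by (subst pos_divide_le_eq) auto
    moreover have "g (k0 + m) \<le> R0" "g (k0 + m) \<le> lam * L (k0 + m)" by (auto simp: g_def)
    moreover have "lam * L (Suc (k0 + m)) * B \<le> g (k0 + m)"
    proof -
      have "g (Suc (k0 + m)) < R0"
      proof (rule ccontr)
        assume "\<not> g (Suc (k0 + m)) < R0"
        then have "R0 * B \<le> g (Suc (k0 + m)) * B" using B by (intro mult_right_mono) auto
        also have "\<dots> \<le> R0" using m \<open>g (k0 + m) \<le> R0\<close> by linarith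
        finally show False using B R0 by simp
      qed
      then show ?thesis using m by (simp add: g_def min_def split: if_splits)
    qed
    ultimately show ?thesis by blast
  qed
  moreover have "R0 / B ^ Suc N > 0" using B R0 by simp
  ultimately show ?thesis by blast
qed

end

section \<open>Microsets\<close>

text \<open>Boundedness of \<open>B\<close> makes the real supremum in \<open>hdist\<close> a
  genuine upper bound; strictness then yields an actual near point.\<close>

lemma hdist_near:
  assumes "hdist A B < e" "b \<in> B" "A \<noteq> {}" "bounded B"
  obtains a where "a \<in> A" "dist b a < e"
proof -
  obtain a0 where a0: "a0 \<in> A" using assms(3) by blast
  obtain D where D: "\<And>b. b \<in> B \<Longrightarrow> dist a0 b \<le> D"
    using assms(4) unfolding bounded_any_center[where a=a0] by blast
  have "infdist b A \<le> (SUP b\<in>B. infdist b A)"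
  proof (rule cSUP_upper[OF assms(2)])
    show "bdd_above ((\<lambda>b. infdist b A) ` B)"
      using infdist_le[OF a0] D by (intro bdd_aboveI2[of _ _ D]) (metis dist_commute order_trans)
  qed
  also have "\<dots> < e" using assms(1) by (simp add: hdist_def)
  finally have "(INF a\<in>A. dist b a) < e" using assms(3) by (simp add: infdist_notempty)
  then show thesis using that assms(3) cInf_lessD[of "dist b ` A" e] by auto
qed


text \<open>One close miniset suffices. Points of \<open>E\<close> within \<open>R\<close> have
  nearby scaled points of the range whose addresses agree through level \<open>k\<close>, and these
  are then much closer because \<open>L\<close> has a gap there.\<close>

lemma microset_isolated_annulus:
  fixes \<pi> :: "(nat \<Rightarrow> 'd::finite) \<Rightarrow> 'a::real_normed_vector"
  assumes scheme: "cantor_scheme \<pi> L M \<eta>"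
    and gaps: "\<And>B. \<exists>N. \<forall>k. \<exists>j\<in>{k..k+N}. L (Suc j) * B \<le> L j"
    and E: "E \<in> microsets (range \<pi>)" and y: "y \<in> E" and R0: "R0 > 0"
  shows "\<exists>r R. 0 < r \<and> r * B \<le> R \<and> R \<le> R0 \<and> E \<inter> cball y R \<subseteq> cball y r"
proof -
  interpret cantor_scheme \<pi> L M \<eta> by (rule scheme)
  obtain A where "compact E" and mini: "\<And>n. miniset (range \<pi>) (A n)"
    and lim: "(\<lambda>n. hdist (A n) E) \<longlonglongrightarrow> 0"
    using E unfolding microsets_def by auto
  \<comment> \<open>The final ratio \<open>R / r\<close> equals
    \<open>\<eta> * B' / (4 * M)\<close>.\<close>
  define B' where "B' = max 2 (4 * M * B / \<eta>)"
  have B': "B' \<ge> 2" "4 * M * B / \<eta> \<le> B'" by (auto simp: B'_def)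
  define R1 where "R1 = min 1 (2 * R0 / \<eta>)"
  have R1: "0 < R1" "R1 \<le> 1" "R1 \<le> 2 * R0 / \<eta>" using R0 \<eta>_pos by (auto simp: R1_def)
  obtain g0 where g0: "g0 > 0" "\<And>lam. lam \<ge> 1 \<Longrightarrow>
      \<exists>k g. g0 \<le> g \<and> g \<le> R1 \<and> g \<le> lam * L k \<and> lam * L (Suc k) * B' \<le> g"
    using exists_gap_scale[OF less_le_trans[OF _ B'(1)] R1(1,2) gaps] by auto
  \<comment> \<open>The error is fixed through \<open>g0\<close> before \<open>n\<close>, hence
    before \<open>lam\<close>, is known. The two terms give
    \<open>2 * e \<le> \<eta> * g / 4\<close> and \<open>2 * e \<le> M * g / B'\<close>.\<close>
  define e where "e = g0 * min (\<eta> / 8) (M / (2 * B'))"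
  have e: "e > 0" using g0 \<eta>_pos M_pos B' by (simp add: e_def)
  obtain n where n: "hdist (A n) E < e"
    using order_tendstoD(2)[OF lim e] by (auto simp: eventually_sequentially)
  obtain x lam where x: "x \<in> range \<pi>" and lam: "lam \<ge> 1"
    and A: "A n = (\<lambda>v. lam *\<^sub>R (v - x)) ` range \<pi> \<inter> cball 0 1"
    using mini[of n] unfolding miniset_def by blast
  obtain k g where g: "g0 \<le> g" "g \<le> R1" "g \<le> lam * L k" "lam * L (Suc k) * B' \<le> g"
    using g0(2)[OF lam] by blast
  have "g > 0" using g(1) g0(1) by simp
  have e_le: "e \<le> \<eta> * g / 8" "e \<le> M * g / (2 * B')"
  proof -
    have "e \<le> g0 * (\<eta> / 8)" using g0 unfolding e_def by (intro mult_left_mono) auto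
    also have "\<dots> \<le> g * (\<eta> / 8)" using g \<eta>_pos by (intro mult_right_mono) auto
    finally show "e \<le> \<eta> * g / 8" by (simp add: mult.commute)
    have "e \<le> g0 * (M / (2 * B'))" using g0 unfolding e_def by (intro mult_left_mono) auto
    also have "\<dots> \<le> g * (M / (2 * B'))" using g M_pos B' by (intro mult_right_mono) auto
    finally show "e \<le> M * g / (2 * B')" by (simp add: mult.commute)
  qed
  have near: "\<exists>\<sigma>. norm (z - lam *\<^sub>R (\<pi> \<sigma> - x)) < e" if "z \<in> E" for z
  proof -
    have "0 \<in> A n" unfolding A using x by (auto intro!: image_eqI[of _ _ x])
    then obtain a where "a \<in> A n" "dist z a < e"
      using hdist_near[OF n \<open>z \<in> E\<close>] compact_imp_bounded[OF \<open>compact E\<close>] by blast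
    then show ?thesis unfolding A dist_norm by auto
  qed
  obtain \<sigma> where \<sigma>: "norm (y - lam *\<^sub>R (\<pi> \<sigma> - x)) < e" using near[OF y] by blast
  define r R where "r = 2 * M * g / B'" and "R = \<eta> * g / 2"
  have "E \<inter> cball y R \<subseteq> cball y r"
  proof safe
    fix z assume "z \<in> E" "z \<in> cball y R"
    obtain \<tau> where \<tau>: "norm (z - lam *\<^sub>R (\<pi> \<tau> - x)) < e" using near[OF \<open>z \<in> E\<close>] by blast
    define u v where "u = y - lam *\<^sub>R (\<pi> \<sigma> - x)" and "v = z - lam *\<^sub>R (\<pi> \<tau> - x)"
    have scaled: "lam *\<^sub>R (\<pi> \<sigma> - \<pi> \<tau>) = (y - z) - (u - v)"
      by (simp add: u_def v_def algebra_simps)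
    have uv: "norm (u - v) < 2 * e"
      using norm_triangle_ineq4[of u v] \<sigma> \<tau> by (simp add: u_def v_def)
    have norm_scaled: "norm (lam *\<^sub>R (\<pi> \<sigma> - \<pi> \<tau>)) = lam * dist (\<pi> \<sigma>) (\<pi> \<tau>)"
      using lam by (simp add: dist_norm)
    have "lam * dist (\<pi> \<sigma>) (\<pi> \<tau>) < R + 2 * e"
      using norm_triangle_ineq4[of "y - z" "u - v"] uv \<open>z \<in> cball y R\<close> scaled norm_scaled
      by (simp add: dist_norm)
    also have "\<dots> \<le> \<eta> * g / 2 + \<eta> * g / 4" using e_le(1) by (simp add: R_def)
    also have "\<dots> \<le> \<eta> * g" using \<open>g > 0\<close> \<eta>_pos by simp
    also have "\<dots> \<le> lam * (\<eta> * L k)" using mult_left_mono[OF g(3), of \<eta>] \<eta>_pos by (simp add: mult_ac)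
    finally have "dist (\<pi> \<sigma>) (\<pi> \<tau>) < \<eta> * L k" using lam by simp
    then have "dist (\<pi> \<sigma>) (\<pi> \<tau>) \<le> M * L (Suc k)"
      using agree_of_dist_less[of \<sigma> \<tau> k] by (intro dist_le) simp
    then have "lam * dist (\<pi> \<sigma>) (\<pi> \<tau>) \<le> lam * (M * L (Suc k))" using lam by (intro mult_left_mono) auto
    also have "\<dots> \<le> M * g / B'"
    proof -
      have "M * (lam * L (Suc k)) \<le> M * (g / B')"
        using g(4) B' M_pos by (intro mult_left_mono) (auto simp: pos_le_divide_eq)
      then show ?thesis by (simp add: mult_ac)
    qed
    finally have "norm (lam *\<^sub>R (\<pi> \<sigma> - \<pi> \<tau>) + (u - v)) < M * g / B' + 2 * e"
      using norm_triangle_ineq[of "lam *\<^sub>R (\<pi> \<sigma> - \<pi> \<tau>)" "u - v"] uv norm_scaled by linarith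
    then have "norm (y - z) < M * g / B' + 2 * e" unfolding scaled by simp
    also have "\<dots> \<le> r" using e_le(2) by (simp add: r_def)
    finally show "z \<in> cball y r" by (simp add: dist_norm)
  qed
  moreover have "0 < r" using M_pos \<open>g > 0\<close> B' by (simp add: r_def)
  moreover have "r * B \<le> R"
  proof -
    have "4 * M * B \<le> B' * \<eta>" using B'(2) \<eta>_pos by (simp add: pos_divide_le_eq)
    then have "(4 * M * B) * g \<le> (B' * \<eta>) * g" using \<open>g > 0\<close> by (intro mult_right_mono) auto
    then show ?thesis using B' by (simp add: r_def R_def field_simps)
  qed
  moreover have "R \<le> R0"
  proof -
    have "\<eta> * g \<le> \<eta> * (2 * R0 / \<eta>)" using g(2) R1(3) \<eta>_pos by (intro mult_left_mono) auto
    then show ?thesis using \<eta>_pos by (simp add: R_def)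
  qed
  ultimately show ?thesis by blast
qed

text \<open>A ball that meets \<open>F\<close> only in a much smaller concentric ball has covering number 1.\<close>

lemma lower_dim_eq_0_of_isolated_annuli:
  assumes "y \<in> F"
    and ann: "\<And>B. \<exists>r R. 0 < r \<and> r * B \<le> R \<and> R \<le> 1/2 \<and> F \<inter> cball y R \<subseteq> cball y r"
  shows "lower_dim F = 0"
proof -
  have False if a: "a > 0" and C: "C > 0" and cov: "\<forall>r R x. 0 < r \<and> r \<le> R \<and> R < 1 \<and> x \<in> F
        \<longrightarrow> real (covnum (cball x R \<inter> F) r) \<ge> C * (R / r) powr a" for a C :: real
  proof -
    \<comment> \<open>With ratio at least \<open>B\<close> the lower bound would be at least
      2.\<close>
    define B where "B = max 1 ((2 / C) powr (1 / a))"
    have B: "B \<ge> 1" "B \<ge> (2 / C) powr (1 / a)" by (auto simp: B_def)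
    obtain r R where r: "0 < r" "r * B \<le> R" "R \<le> 1/2" "F \<inter> cball y R \<subseteq> cball y r"
      using ann by blast
    have "r \<le> R" using mult_left_mono[of 1 B r] r(1,2) B(1) by linarith
    have "2 / C = ((2 / C) powr (1 / a)) powr a" using a C by (simp add: powr_powr)
    also have "\<dots> \<le> (R / r) powr a"
    proof (intro powr_mono2)
      have "B \<le> R / r" using r by (simp add: pos_le_divide_eq mult.commute)
      then show "(2 / C) powr (1 / a) \<le> R / r" using B(2) by linarith
    qed (use a in auto)
    finally have "2 \<le> C * (R / r) powr a" using C by (simp add: field_simps)
    also have "\<dots> \<le> real (covnum (cball y R \<inter> F) r)"
      using cov r \<open>r \<le> R\<close> \<open>y \<in> F\<close> by auto
    also have "covnum (cball y R \<inter> F) r \<le> card {y}"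
      using r \<open>r \<le> R\<close> \<open>y \<in> F\<close> by (intro covnum_le_card) auto
    finally show False by simp
  qed
  then have "{a. a > 0 \<and> (\<exists>C>0. \<forall>r R x. 0 < r \<and> r \<le> R \<and> R < 1 \<and> x \<in> F
        \<longrightarrow> real (covnum (cball x R \<inter> F) r) \<ge> C * (R / r) powr a)} = {}" by blast
  then show ?thesis unfolding lower_dim_def by (simp only: image_empty) simp
qed

text \<open>The balls of radius \<open>r\<close> and \<open>R\<close> cut out the same part of
  \<open>F\<close>, so regularity would bound \<open>(R / r) powr s\<close> by
  \<open>C\<^sup>2\<close>. Two distinct points make the diameter positive, so that radii are
  admissible.\<close>

lemma not_AD_regular_of_isolated_annuli:
  assumes "bounded F" "x \<in> F" "y \<in> F" "x \<noteq> y" "s > 0"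
    and ann: "\<And>R0 B. R0 > 0 \<Longrightarrow> \<exists>r R. 0 < r \<and> r * B \<le> R \<and> R \<le> R0 \<and> F \<inter> cball y R \<subseteq> cball y r"
  shows "\<not> AD_regular s F"
proof
  assume "AD_regular s F"
  then obtain C where C: "C \<ge> 1" and reg: "\<And>x r. x \<in> F \<Longrightarrow> 0 < r \<Longrightarrow> r < diameter F \<Longrightarrow>
      ennreal (r powr s / C) \<le> hausdorff_measure s (F \<inter> cball x r) \<and>
      hausdorff_measure s (F \<inter> cball x r) \<le> ennreal (C * r powr s)"
    unfolding AD_regular_def by blast
  have diam: "diameter F > 0"
    using diameter_bounded_bound[OF assms(1-3)] assms(4) by (smt (verit) zero_less_dist_iff)
  define B where "B = max 1 ((2 * C\<^sup>2) powr (1 / s))"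
  have B: "B \<ge> 1" "B \<ge> (2 * C\<^sup>2) powr (1 / s)" by (auto simp: B_def)
  obtain r R where r: "0 < r" "r * B \<le> R" "R \<le> diameter F / 2" "F \<inter> cball y R \<subseteq> cball y r"
    using ann[of "diameter F / 2" B] diam by auto
  have "r \<le> R" using mult_left_mono[of 1 B r] r(1,2) B(1) by linarith
  then have eq: "F \<inter> cball y R = F \<inter> cball y r" using r(4) by auto
  have "ennreal (R powr s / C) \<le> ennreal (C * r powr s)"
  proof (rule order_trans)
    show "ennreal (R powr s / C) \<le> hausdorff_measure s (F \<inter> cball y r)"
      using reg[OF assms(3), of R] r \<open>r \<le> R\<close> diam unfolding eq by auto
    show "hausdorff_measure s (F \<inter> cball y r) \<le> ennreal (C * r powr s)"
      using reg[OF assms(3), of r] r \<open>r \<le> R\<close> diam by auto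
  qed
  then have "R powr s / C \<le> C * r powr s" using C by (subst (asm) ennreal_le_iff) auto
  then have "R powr s \<le> C\<^sup>2 * r powr s" using C by (simp add: pos_divide_le_eq power2_eq_square mult_ac)
  then have "(R / r) powr s \<le> C\<^sup>2" using r \<open>r \<le> R\<close> by (simp add: powr_divide pos_divide_le_eq)
  moreover have "2 * C\<^sup>2 = ((2 * C\<^sup>2) powr (1 / s)) powr s" using assms C by (simp add: powr_powr)
  moreover have "\<dots> \<le> (R / r) powr s"
  proof (intro powr_mono2)
    have "B \<le> R / r" using r by (simp add: pos_le_divide_eq mult.commute)
    then show "(2 * C\<^sup>2) powr (1 / s) \<le> R / r" using B(2) by linarith
  qed (use assms in auto)
  ultimately have "2 * C\<^sup>2 \<le> C\<^sup>2" by linarith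
  then show False using C by simp
qed

section \<open>The construction\<close>

lemma scales_geometric:
  fixes L :: "nat \<Rightarrow> real"
  assumes "\<And>k. L (Suc k) \<le> \<rho> * L k" "\<rho> > 0"
  shows "L (k + j) \<le> \<rho> ^ j * L k"
proof (induction j)
  case (Suc j)
  have "L (k + Suc j) \<le> \<rho> * L (k + j)" using assms(1)[of "k + j"] by simp
  also have "\<dots> \<le> \<rho> * (\<rho> ^ j * L k)" using Suc assms(2) by (intro mult_left_mono) auto
  finally show ?case by simp
qed simp

text \<open>One coordinate of a point of \<open>K\<close>. A 0/1 vector is encoded as a subset of
  the index type, so a coordinate sees a Boolean sequence.\<close>

definition digit_sum :: "(nat \<Rightarrow> real) \<Rightarrow> (nat \<Rightarrow> bool) \<Rightarrow> real" where
  "digit_sum L \<sigma> = (\<Sum>k. of_bool (\<sigma> k) * L k)"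

context
  fixes L :: "nat \<Rightarrow> real" and \<rho> :: real
  assumes L_pos: "\<And>k. L k > 0" and L_Suc: "\<And>k. L (Suc k) \<le> \<rho> * L k"
    and \<rho>: "0 < \<rho>" "\<rho> < 1"
begin

lemma summable_digits: "summable (\<lambda>j. of_bool (\<sigma> j) * L j)"
proof (rule summable_comparison_test'[of "\<lambda>j. \<rho> ^ j * L 0" 0])
  show "summable (\<lambda>j. \<rho> ^ j * L 0)" using \<rho> by (intro summable_mult2 summable_geometric) simp
  fix j
  have "norm (of_bool (\<sigma> j) * L j) \<le> L j" using L_pos[of j] by simp
  also have "\<dots> \<le> \<rho> ^ j * L 0" using scales_geometric[of L, OF L_Suc \<rho>(1), of 0 j] by simp
  finally show "norm (of_bool (\<sigma> j) * L j) \<le> \<rho> ^ j * L 0" .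
qed

lemma digit_sum_diff_le:
  assumes "\<And>i. i < k \<Longrightarrow> \<sigma> i = \<tau> i"
  shows "\<bar>digit_sum L \<sigma> - digit_sum L \<tau>\<bar> \<le> L k / (1 - \<rho>)"
proof -
  define d where "d j = of_bool (\<sigma> j) * L j - of_bool (\<tau> j) * L j" for j
  have d: "d sums (digit_sum L \<sigma> - digit_sum L \<tau>)"
    unfolding d_def digit_sum_def by (intro sums_diff summable_sums summable_digits)
  have "digit_sum L \<sigma> - digit_sum L \<tau> = (\<Sum>j. d (j + k)) + (\<Sum>j<k. d j)"
    using suminf_split_initial_segment[OF sums_summable[OF d], of k] sums_unique[OF d] by simp
  also have "(\<Sum>j<k. d j) = 0" using assms by (simp add: d_def)
  finally have eq: "digit_sum L \<sigma> - digit_sum L \<tau> = (\<Sum>j. d (j + k))" by simp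
  have geo: "(\<lambda>j. \<rho> ^ j * L k) sums (L k / (1 - \<rho>))"
    using sums_mult2[OF geometric_sums[of \<rho>], of "L k"] \<rho> by simp
  have bound: "norm (d (j + k)) \<le> \<rho> ^ j * L k" for j
  proof -
    have "norm (d (j + k)) \<le> L (k + j)" using L_pos[of "k + j"] by (simp add: d_def add.commute)
    then show ?thesis using scales_geometric[of L, OF L_Suc \<rho>(1), of k j] by simp
  qed
  have "norm (\<Sum>j. d (j + k)) \<le> (\<Sum>j. \<rho> ^ j * L k)"
    by (rule norm_suminf_le[OF bound sums_summable[OF geo]])
  then show ?thesis unfolding eq using sums_unique[OF geo] by simp
qed

text \<open>Changing only digit \<open>k\<close> moves the sum by exactly \<open>L k\<close>; the
  later digits can undo at most \<open>\<rho> / (1 - \<rho>)\<close> of this.\<close>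

lemma digit_sum_diff_ge:
  assumes "\<And>i. i < k \<Longrightarrow> \<sigma> i = \<tau> i" "\<sigma> k \<noteq> \<tau> k"
  shows "(1 - \<rho> / (1 - \<rho>)) * L k \<le> \<bar>digit_sum L \<sigma> - digit_sum L \<tau>\<bar>"
proof -
  define \<sigma>' where "\<sigma>' = \<sigma>(k := \<tau> k)"
  let ?c = "of_bool (\<sigma> k) * L k - of_bool (\<tau> k) * L k"
  have "(\<lambda>j. of_bool (\<sigma> j) * L j - of_bool (\<sigma>' j) * L j) sums (digit_sum L \<sigma> - digit_sum L \<sigma>')"
    unfolding digit_sum_def by (intro sums_diff summable_sums summable_digits)
  moreover have "(\<lambda>j. of_bool (\<sigma> j) * L j - of_bool (\<sigma>' j) * L j) = (\<lambda>j. if j = k then ?c else 0)"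
    by (auto simp: \<sigma>'_def)
  moreover have "(\<lambda>j. if j = k then ?c else 0) sums ?c" by (rule sums_single)
  ultimately have "digit_sum L \<sigma> - digit_sum L \<sigma>' = ?c" by (simp add: sums_unique2)
  moreover have "\<bar>?c\<bar> = L k" using assms(2) L_pos[of k] by (cases "\<sigma> k"; cases "\<tau> k") auto
  ultimately have first: "\<bar>digit_sum L \<sigma> - digit_sum L \<sigma>'\<bar> = L k" by simp
  have "\<bar>digit_sum L \<sigma>' - digit_sum L \<tau>\<bar> \<le> L (Suc k) / (1 - \<rho>)"
    by (rule digit_sum_diff_le) (use assms in \<open>auto simp: \<sigma>'_def less_Suc_eq\<close>)
  also have "\<dots> \<le> \<rho> * L k / (1 - \<rho>)" using L_Suc \<rho> by (intro divide_right_mono) auto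
  finally have "\<bar>digit_sum L \<sigma>' - digit_sum L \<tau>\<bar> \<le> \<rho> / (1 - \<rho>) * L k" by simp
  then show ?thesis using first by (simp add: left_diff_distrib)
qed

end

text \<open>The upper estimate sums over the coordinates; the lower one uses a single coordinate in
  which the digits differ. The separation constant is positive because
  \<open>\<rho> < 1/2\<close>.\<close>

lemma cantor_scheme_digit_sums:
  fixes L :: "nat \<Rightarrow> real"
  assumes L: "L 0 = 1" "\<And>k. L k > 0" "\<And>k. L (Suc k) \<le> \<rho> * L k" and \<rho>: "0 < \<rho>" "\<rho> < 1/2"
  shows "cantor_scheme (\<lambda>\<omega> :: nat \<Rightarrow> 'n::finite set. (\<chi> i. digit_sum L (\<lambda>k. i \<in> \<omega> k)) :: real^'n)
    L (real CARD('n) / (1 - \<rho>)) (1 - \<rho> / (1 - \<rho>))"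
    (is "cantor_scheme ?\<pi> L ?M ?\<eta>")
proof
  have \<rho>1: "\<rho> < 1" using \<rho> by simp
  show "L k > 0" for k by (rule L)
  show "decseq L"
  proof (rule decseq_SucI)
    fix k
    have "L (Suc k) \<le> \<rho> * L k" by (rule L)
    also have "\<dots> \<le> L k" using \<rho>1 L(2)[of k] by simp
    finally show "L (Suc k) \<le> L k" .
  qed
  show "L \<longlonglongrightarrow> 0"
  proof (rule tendsto_sandwich[of "\<lambda>_. 0" _ _ "\<lambda>k. \<rho> ^ k"])
    show "\<forall>\<^sub>F k in sequentially. L k \<le> \<rho> ^ k"
      using scales_geometric[of L, OF L(3) \<rho>(1), of 0] L(1) by simp
    show "(\<lambda>k. \<rho> ^ k) \<longlonglongrightarrow> 0" using \<rho> by (intro LIMSEQ_power_zero) simp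
    show "\<forall>\<^sub>F k in sequentially. 0 \<le> L k" using L(2) by (simp add: less_imp_le)
  qed simp
  show "L 0 = 1" by (rule L)
  show "?M > 0" using \<rho>1 by simp
  show "?\<eta> > 0" using \<rho> by simp
  show "dist (?\<pi> \<sigma>) (?\<pi> \<tau>) \<le> ?M * L k" if "\<And>i. i < k \<Longrightarrow> \<sigma> i = \<tau> i" for \<sigma> \<tau> k
  proof -
    have "norm (?\<pi> \<sigma> - ?\<pi> \<tau>) \<le> (\<Sum>i\<in>UNIV. \<bar>(?\<pi> \<sigma> - ?\<pi> \<tau>) $ i\<bar>)" by (rule norm_le_l1_cart)
    also have "\<dots> \<le> (\<Sum>i\<in>(UNIV::'n set). L k / (1 - \<rho>))"
    proof (rule sum_mono)
      fix i :: 'n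
      show "\<bar>(?\<pi> \<sigma> - ?\<pi> \<tau>) $ i\<bar> \<le> L k / (1 - \<rho>)"
        using digit_sum_diff_le[of L, OF L(2,3) \<rho>(1) \<rho>1, of k "\<lambda>k. i \<in> \<sigma> k" "\<lambda>k. i \<in> \<tau> k"] that by simp
    qed
    finally show ?thesis by (simp add: dist_norm)
  qed
  show "?\<eta> * L k \<le> dist (?\<pi> \<sigma>) (?\<pi> \<tau>)" if "\<And>i. i < k \<Longrightarrow> \<sigma> i = \<tau> i" "\<sigma> k \<noteq> \<tau> k" for \<sigma> \<tau> k
  proof -
    obtain i where i: "(i \<in> \<sigma> k) \<noteq> (i \<in> \<tau> k)" using \<open>\<sigma> k \<noteq> \<tau> k\<close> by blast
    have "?\<eta> * L k \<le> \<bar>(?\<pi> \<sigma> - ?\<pi> \<tau>) $ i\<bar>"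
      using digit_sum_diff_ge[of L, OF L(2,3) \<rho>(1) \<rho>1, of k "\<lambda>k. i \<in> \<sigma> k" "\<lambda>k. i \<in> \<tau> k"] that(1) i by simp
    also have "\<dots> \<le> norm (?\<pi> \<sigma> - ?\<pi> \<tau>)" by (rule component_le_norm_cart)
    finally show ?thesis by (simp add: dist_norm)
  qed
qed

text \<open>The last clause asks for two points in \<open>F\<close>: a closed set of diameter 0
  admits no radius and would be regular vacuously.\<close>

theorem theoremA:
  fixes \<alpha> :: real
  assumes "0 \<le> \<alpha>" and "\<alpha> < real CARD('n::finite)"
  shows "\<exists>K :: (real^'n) set. K \<noteq> {} \<and> compact K \<and>
           hausdorff_dim K = ereal \<alpha> \<and> assouad_dim K = ereal \<alpha> \<and>
           (\<forall>E\<in>microsets K. mod_lower_dim E = 0) \<and>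
           (\<forall>s>0. \<forall>E\<in>microsets K. \<not> (\<exists>F. F \<subseteq> E \<and> (\<exists>x y. x \<in> F \<and> y \<in> F \<and> x \<noteq> y) \<and> AD_regular s F))"
proof -
  obtain t c where c: "c > 1" and t0: "t 0 = 0" and step: "\<And>k. t (Suc k) \<ge> t k + c"
    and upper: "\<And>k. \<alpha> * t k \<le> real CARD('n) * real k"
    and growth: "\<And>a. a > \<alpha> \<Longrightarrow> \<exists>C. \<forall>k n. real CARD('n) * real n \<le> a * (t (k + n) - t k) + C"
    and gaps: "\<And>m. \<exists>N. \<forall>k. \<exists>j\<in>{k..k+N}. t (Suc j) - t j \<ge> m"
    by (rule exists_scales[OF assms]) blast
  define L where "L k = 2 powr (- t k)" for k
  define \<rho> :: real where "\<rho> = 2 powr (- c)"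
  define \<pi> :: "(nat \<Rightarrow> 'n set) \<Rightarrow> real^'n" where "\<pi> \<omega> = (\<chi> i. digit_sum L (\<lambda>k. i \<in> \<omega> k))" for \<omega>
  define M where "M = real CARD('n) / (1 - \<rho>)"
  define \<eta> where "\<eta> = 1 - \<rho> / (1 - \<rho>)"
  have "\<rho> < 2 powr (- 1)" unfolding \<rho>_def using c by (intro powr_less_mono) auto
  then have \<rho>: "0 < \<rho>" "\<rho> < 1/2" by (auto simp: \<rho>_def powr_minus)
  have scheme: "cantor_scheme \<pi> L M \<eta>"
    unfolding \<pi>_def M_def \<eta>_def
  proof (rule cantor_scheme_digit_sums[OF _ _ _ \<rho>])
    show "L (Suc k) \<le> \<rho> * L k" for k
      using step[of k] by (simp add: L_def \<rho>_def flip: powr_add)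
  qed (auto simp: L_def t0)
  interpret cantor_scheme \<pi> L M \<eta> by (rule scheme)
  have card: "CARD('n set) = 2 ^ CARD('n)" by simp
  \<comment> \<open>The alphabet has \<open>2 ^ CARD('n)\<close> letters, so word counts are powers
    of 2 comparable with \<open>L k = 2 powr (- t k)\<close>.\<close>
  have pow: "real CARD('n set) ^ k = 2 powr (real CARD('n) * real k)" for k
    by (simp add: card powr_realpow flip: power_mult of_nat_mult)
  have mass: "(1 / real CARD('n set)) ^ j \<le> L j powr \<alpha>" for j
  proof -
    have "(1 / real CARD('n set)) ^ j = 2 powr (- (real CARD('n) * real j))"
      using pow[of j] by (simp only: power_one_over powr_minus inverse_eq_divide)
    also have "\<dots> \<le> 2 powr (- (\<alpha> * t j))" using upper[of j] by (intro powr_mono) auto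
    also have "\<dots> = L j powr \<alpha>" by (simp add: L_def powr_powr mult.commute)
    finally show ?thesis .
  qed
  have L_ratio: "L k / L j = 2 powr (t j - t k)" for k j
    by (simp add: L_def powr_diff powr_minus field_simps)
  let ?K = "range \<pi>"
  have lower: "ereal \<alpha> \<le> hausdorff_dim ?K" by (rule hausdorff_dim_ge[OF mass])
  have "assouad_dim ?K \<le> ereal a" if a: "a > \<alpha>" for a
  proof -
    obtain C where C: "\<And>k n. real CARD('n) * real n \<le> a * (t (k + n) - t k) + C"
      using growth[OF a] by blast
    have "real CARD('n set) ^ n \<le> 2 powr C * (L k / L (k + n)) powr a" for k n
    proof -
      have "real CARD('n set) ^ n \<le> 2 powr (C + (t (k + n) - t k) * a)"
        unfolding pow using C[of n k] by (intro powr_mono) (auto simp: mult.commute)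
      then show ?thesis by (simp add: L_ratio powr_powr powr_add)
    qed
    then show ?thesis
      unfolding assouad_dim_def using assouad_bound[of a "2 powr C"] a assms
      by (intro Inf_lower) auto
  qed
  then have upper: "assouad_dim ?K \<le> ereal \<alpha>"
    by (intro ereal_le_epsilon2[of "assouad_dim ?K" "ereal \<alpha>"]) auto
  have gaps': "\<exists>N. \<forall>k. \<exists>j\<in>{k..k+N}. L (Suc j) * B \<le> L j" for B
  proof -
    \<comment> \<open>Large increments of \<open>t\<close> become large ratios of \<open>L\<close>;
      the maximum with 1 keeps the logarithm meaningful for arbitrary \<open>B\<close>.\<close>
    obtain N where N: "\<And>k. \<exists>j\<in>{k..k+N}. t (Suc j) - t j \<ge> log 2 (max 1 B)" using gaps by blast
    have "L (Suc j) * B \<le> L j" if "t (Suc j) - t j \<ge> log 2 (max 1 B)" for j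
    proof -
      have "B \<le> max 1 B" by simp
      also have "\<dots> = 2 powr (log 2 (max 1 B))" by simp
      also have "\<dots> \<le> L j / L (Suc j)" unfolding L_ratio using that by (intro powr_mono) auto
      finally show ?thesis using scale_pos[of "Suc j"] by (simp add: pos_le_divide_eq mult.commute)
    qed
    then show ?thesis using N by blast
  qed
  have annuli: "\<exists>r R. 0 < r \<and> r * B \<le> R \<and> R \<le> R0 \<and> F \<inter> cball y R \<subseteq> cball y r"
    if "E \<in> microsets ?K" "F \<subseteq> E" "y \<in> F" "R0 > 0" for E F y R0 B
  proof -
    have "y \<in> E" using that(2,3) by blast
    then have "\<exists>r R. 0 < r \<and> r * B \<le> R \<and> R \<le> R0 \<and> E \<inter> cball y R \<subseteq> cball y r"
      by (rule microset_isolated_annulus[OF scheme gaps' that(1) _ that(4)])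
    then show ?thesis using that(2) by blast
  qed
  have "mod_lower_dim E = 0" if E: "E \<in> microsets ?K" for E
  proof -
    have 0: "lower_dim F = 0" if "F \<noteq> {}" "F \<subseteq> E" for F
    proof -
      obtain y where "y \<in> F" using \<open>F \<noteq> {}\<close> by blast
      then show ?thesis
        by (rule lower_dim_eq_0_of_isolated_annuli) (rule annuli[OF E that(2) \<open>y \<in> F\<close>], simp)
    qed
    \<comment> \<open>An empty family would have supremum minus infinity in
      \<open>ereal\<close>.\<close>
    have "E \<noteq> {}" using E by (simp add: microsets_def)
    have "mod_lower_dim E = (SUP F\<in>{F. F \<noteq> {} \<and> F \<subseteq> E}. lower_dim F)"
      by (simp add: mod_lower_dim_def image_Collect)
    also have "\<dots> = (SUP F\<in>{F. F \<noteq> {} \<and> F \<subseteq> E}. 0)" by (intro SUP_cong) (simp_all add: 0)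
    also have "\<dots> = 0" using \<open>E \<noteq> {}\<close> by (intro SUP_const) auto
    finally show ?thesis .
  qed
  moreover have "\<not> AD_regular s F" if "s > 0" "E \<in> microsets ?K" "F \<subseteq> E" "x \<in> F" "y \<in> F" "x \<noteq> y" for s E F x y
  proof (rule not_AD_regular_of_isolated_annuli[OF _ that(4-6,1) annuli[OF that(2,3,5)]])
    show "bounded F"
      using that(2,3) by (auto simp: microsets_def intro: bounded_subset[OF compact_imp_bounded])
  qed
  moreover have "hausdorff_dim ?K = ereal \<alpha>" "assouad_dim ?K = ereal \<alpha>"
    using lower upper hausdorff_dim_le_assouad_dim[OF compact_range] by (meson antisym order_trans)+
  ultimately show ?thesis
    using compact_range by (intro exI[of _ ?K] conjI ballI allI impI) blast+
qed

end
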